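(* Let $(\mathcal{V},\mathcal{E})$ be a finite directed graph whose adjacency matrix $M$ is irreducible and is not a permutation matrix, let $(X,\sigma)$ be the associated one-sided shift of finite type and let $G$ be the étale groupoid of $(X,\sigma)$. For any non-empty clopen set $Y\subset X$, the étale groupoid $G|Y$ is purely infinite and minimal.
   Context: Étale groupoids: an étale groupoid is a second countable locally compact Hausdorff topological groupoid $G$ whose range map is a local homeomorphism. $G^{(0)}$ is the unit space, $s,r$ are the source and range maps, and $gh$ is defined when $s(g)=r(h)$. The $G$-orbit of $x\in G^{(0)}$ is $\{r(g)\mid g\in G,\ s(g)=x\}$; $G$ is minimal if every $G$-orbit is dense in $G^{(0)}$. For an open set $Y\subset G^{(0)}$, $G|Y=r^{-1}(Y)\cap s^{-1}(Y)$ is the reduction, an étale groupoid with unit space $Y$. A $G$-set is a subset $U\subset G$ such that $r|U$ and $s|U$ are injective. A clopen (closed and open) set $A\subset G^{(0)}$ is properly infinite if there exist compact open $G$-sets $U,V\subset G$ such that $s(U)=s(V)=A$, $r(U)\cup r(V)\subset A$ and $r(U)\cap r(V)=\emptyset$. $G$ is purely infinite if every clopen set $A\subset G^{(0)}$ is properly infinite. Shifts of finite type: $\mathbb{N}=\{1,2,\dots\}$. For $e\in\mathcal{E}$, $i(e)$ and $t(e)$ are the initial and terminal vertices. $M(\xi,\eta)=\#\{e\in\mathcal{E}\mid i(e)=\xi,\ t(e)=\eta\}$; $M$ is irreducible if for all $\xi,\eta\in\mathcal{V}$ there is $n\in\mathbb{N}$ with $M^n(\xi,\eta)>0$. $X=\{(x_k)_{k\in\mathbb{N}}\in\mathcal{E}^{\mathbb{N}}\mid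 t(x_k)=i(x_{k+1})\ \forall k\}$ with the product topology (a Cantor set), and $\sigma:X\to X$, $\sigma(x)_k=x_{k+1}$. The étale groupoid of $(X,\sigma)$ is $G=\{(x,n,y)\in X\times\mathbb{Z}\times X\mid\exists k,l\in\mathbb{N},\ n=k-l,\ \sigma^k(x)=\sigma^l(y)\}$, with product $(x,n,y)(y,n',y')=(x,n+n',y')$, inverse $(x,n,y)^{-1}=(y,-n,x)$, and topology generated by the sets $\{(x,k-l,y)\in G\mid x\in A,\ y\in B,\ \sigma^k(x)=\sigma^l(y)\}$ for $A,B\subset X$ open and $k,l\in\mathbb{N}$. $X$ is identified with $G^{(0)}$ via $x\mapsto(x,0,x)$. *)

theory Defs
  imports
    "HOL-Analysis.Analysis"
    "HOL-Combinatorics.Permutations"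
    "Graph_Theory.Digraph"
begin

section \<open>Etale groupoids\<close>

text \<open>
  A topological groupoid is given by its space of arrows; units are themselves arrows, so source and
  range take values in the arrow space. The product of \<open>g\<close> and \<open>h\<close> is only meaningful if
  \<open>gsrc G g = grng G h\<close>.
\<close>

record 'g top_groupoid =
  gtop :: "'g topology"
  gsrc :: "'g \<Rightarrow> 'g"
  grng :: "'g \<Rightarrow> 'g"
  gmul :: "'g \<Rightarrow> 'g \<Rightarrow> 'g"
  ginv :: "'g \<Rightarrow> 'g"

definition arrows :: "('g, 'z) top_groupoid_scheme \<Rightarrow> 'g set" where
  "arrows G = topspace (gtop G)"

definition units :: "('g, 'z) top_groupoid_scheme \<Rightarrow> 'g set" where
  "units G = gsrc G ` arrows G"

definition unit_space :: "('g, 'z) top_groupoid_scheme \<Rightarrow> 'g topology" where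
  "unit_space G = subtopology (gtop G) (units G)"

definition composable :: "('g, 'z) top_groupoid_scheme \<Rightarrow> ('g \<times> 'g) set" where
  "composable G = {(g, h). g \<in> arrows G \<and> h \<in> arrows G \<and> gsrc G g = grng G h}"

definition local_homeomorphism :: "'a topology \<Rightarrow> 'b topology \<Rightarrow> ('a \<Rightarrow> 'b) \<Rightarrow> bool" where
  "local_homeomorphism X Y f \<longleftrightarrow>
     (\<forall>x \<in> topspace X. \<exists>U. openin X U \<and> x \<in> U \<and> openin Y (f ` U) \<and>
        homeomorphic_map (subtopology X U) (subtopology Y (f ` U)) f)"

locale groupoid =
  fixes G :: "('g, 'z) top_groupoid_scheme"
  assumes src_closed: "g \<in> arrows G \<Longrightarrow> gsrc G g \<in> arrows G"
    and rng_closed: "g \<in> arrows G \<Longrightarrow> grng G g \<in> arrows G"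
    and src_src: "g \<in> arrows G \<Longrightarrow> gsrc G (gsrc G g) = gsrc G g"
    and rng_src: "g \<in> arrows G \<Longrightarrow> grng G (gsrc G g) = gsrc G g"
    and src_rng: "g \<in> arrows G \<Longrightarrow> gsrc G (grng G g) = grng G g"
    and rng_rng: "g \<in> arrows G \<Longrightarrow> grng G (grng G g) = grng G g"
    and mul_closed: "(g, h) \<in> composable G \<Longrightarrow> gmul G g h \<in> arrows G"
    and src_mul: "(g, h) \<in> composable G \<Longrightarrow> gsrc G (gmul G g h) = gsrc G h"
    and rng_mul: "(g, h) \<in> composable G \<Longrightarrow> grng G (gmul G g h) = grng G g"
    and mul_assoc: "(g, h) \<in> composable G \<Longrightarrow> (h, k) \<in> composable G \<Longrightarrow>
          gmul G (gmul G g h) k = gmul G g (gmul G h k)"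
    and mul_src: "g \<in> arrows G \<Longrightarrow> gmul G g (gsrc G g) = g"
    and rng_mul_left: "g \<in> arrows G \<Longrightarrow> gmul G (grng G g) g = g"
    and inv_closed: "g \<in> arrows G \<Longrightarrow> ginv G g \<in> arrows G"
    and src_inv: "g \<in> arrows G \<Longrightarrow> gsrc G (ginv G g) = grng G g"
    and rng_inv: "g \<in> arrows G \<Longrightarrow> grng G (ginv G g) = gsrc G g"
    and mul_inv: "g \<in> arrows G \<Longrightarrow> gmul G g (ginv G g) = grng G g"
    and inv_mul: "g \<in> arrows G \<Longrightarrow> gmul G (ginv G g) g = gsrc G g"

locale topological_groupoid = groupoid G
  for G :: "('g, 'z) top_groupoid_scheme" +
  assumes continuous_mul:
      "continuous_map (subtopology (prod_topology (gtop G) (gtop G)) (composable G)) (gtop G)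
         (\<lambda>(g, h). gmul G g h)"
    and continuous_inv: "continuous_map (gtop G) (gtop G) (ginv G)"

locale etale_groupoid = topological_groupoid G
  for G :: "('g, 'z) top_groupoid_scheme" +
  assumes second_countable: "second_countable (gtop G)"
    and locally_compact: "locally_compact_space (gtop G)"
    and Hausdorff: "Hausdorff_space (gtop G)"
    and local_homeomorphism_rng: "local_homeomorphism (gtop G) (unit_space G) (grng G)"

definition orbit :: "('g, 'z) top_groupoid_scheme \<Rightarrow> 'g \<Rightarrow> 'g set" where
  "orbit G x = {grng G g | g. g \<in> arrows G \<and> gsrc G g = x}"

definition minimal :: "('g, 'z) top_groupoid_scheme \<Rightarrow> bool" where
  "minimal G \<longleftrightarrow> (\<forall>x \<in> units G. unit_space G closure_of orbit G x = units G)"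

definition reduction :: "('g, 'z) top_groupoid_scheme \<Rightarrow> 'g set \<Rightarrow> ('g, 'z) top_groupoid_scheme" where
  "reduction G Y =
     G\<lparr>gtop := subtopology (gtop G) {g \<in> arrows G. grng G g \<in> Y \<and> gsrc G g \<in> Y}\<rparr>"

definition is_G_set :: "('g, 'z) top_groupoid_scheme \<Rightarrow> 'g set \<Rightarrow> bool" where
  "is_G_set G U \<longleftrightarrow> U \<subseteq> arrows G \<and> inj_on (grng G) U \<and> inj_on (gsrc G) U"

definition compact_open_G_set :: "('g, 'z) top_groupoid_scheme \<Rightarrow> 'g set \<Rightarrow> bool" where
  "compact_open_G_set G U \<longleftrightarrow> is_G_set G U \<and> compactin (gtop G) U \<and> openin (gtop G) U"

definition clopenin :: "'a topology \<Rightarrow> 'a set \<Rightarrow> bool" where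
  "clopenin X A \<longleftrightarrow> closedin X A \<and> openin X A"

definition properly_infinite :: "('g, 'z) top_groupoid_scheme \<Rightarrow> 'g set \<Rightarrow> bool" where
  "properly_infinite G A \<longleftrightarrow>
     (\<exists>U V. compact_open_G_set G U \<and> compact_open_G_set G V \<and>
        gsrc G ` U = A \<and> gsrc G ` V = A \<and>
        grng G ` U \<union> grng G ` V \<subseteq> A \<and> grng G ` U \<inter> grng G ` V = {})"

definition purely_infinite :: "('g, 'z) top_groupoid_scheme \<Rightarrow> bool" where
  "purely_infinite G \<longleftrightarrow> (\<forall>A. clopenin (unit_space G) A \<longrightarrow> properly_infinite G A)"


section \<open>Shifts of finite type\<close>

definition adj_matrix :: "('v, 'e) pre_digraph \<Rightarrow> 'v \<Rightarrow> 'v \<Rightarrow> nat" where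
  "adj_matrix D \<xi> \<eta> = card {e \<in> arcs D. tail D e = \<xi> \<and> head D e = \<eta>}"

text \<open>Powers of a square matrix whose rows and columns are indexed by the finite set \<open>I\<close>.\<close>

primrec matrix_pow :: "'v set \<Rightarrow> ('v \<Rightarrow> 'v \<Rightarrow> nat) \<Rightarrow> nat \<Rightarrow> 'v \<Rightarrow> 'v \<Rightarrow> nat" where
  "matrix_pow I M 0 = (\<lambda>\<xi> \<eta>. if \<xi> = \<eta> then 1 else 0)"
| "matrix_pow I M (Suc n) = (\<lambda>\<xi> \<eta>. \<Sum>\<zeta>\<in>I. matrix_pow I M n \<xi> \<zeta> * M \<zeta> \<eta>)"

definition irreducible_matrix :: "'v set \<Rightarrow> ('v \<Rightarrow> 'v \<Rightarrow> nat) \<Rightarrow> bool" where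
  "irreducible_matrix I M \<longleftrightarrow> (\<forall>\<xi>\<in>I. \<forall>\<eta>\<in>I. \<exists>n\<ge>1. matrix_pow I M n \<xi> \<eta> > 0)"

definition permutation_matrix :: "'v set \<Rightarrow> ('v \<Rightarrow> 'v \<Rightarrow> nat) \<Rightarrow> bool" where
  "permutation_matrix I M \<longleftrightarrow>
     (\<exists>\<pi>. \<pi> permutes I \<and> (\<forall>\<xi>\<in>I. \<forall>\<eta>\<in>I. M \<xi> \<eta> = (if \<eta> = \<pi> \<xi> then 1 else 0)))"

text \<open>
  A sequence \<open>(x\<^sub>1, x\<^sub>2, \<dots>)\<close> of edges is encoded as a function on \<^typ>\<open>nat\<close>, with \<open>x\<^sub>1\<close> at argument 0.
\<close>

definition sft :: "('v, 'e) pre_digraph \<Rightarrow> (nat \<Rightarrow> 'e) set" where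
  "sft D = {x. \<forall>k. x k \<in> arcs D \<and> head D (x k) = tail D (x (Suc k))}"

definition sft_space :: "('v, 'e) pre_digraph \<Rightarrow> (nat \<Rightarrow> 'e) topology" where
  "sft_space D = subtopology (product_topology (\<lambda>_. discrete_topology (arcs D)) UNIV) (sft D)"

definition shift :: "(nat \<Rightarrow> 'e) \<Rightarrow> nat \<Rightarrow> 'e" where
  "shift x = (\<lambda>k. x (Suc k))"

type_synonym 'e sft_arrow = "(nat \<Rightarrow> 'e) \<times> int \<times> (nat \<Rightarrow> 'e)"

text \<open>
  The exponents \<open>k\<close> and \<open>l\<close> range over the positive integers. The space of arrows is the union of the
  sets below, that is, all \<open>(x, n, y)\<close> such that \<open>n = k - l\<close> and \<open>\<sigma>\<^sup>k x = \<sigma>\<^sup>l y\<close> for some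
  \<open>k, l \<ge> 1\<close> (take \<open>A = B = X\<close>).
\<close>

definition sft_basic ::
    "(nat \<Rightarrow> 'e) set \<Rightarrow> (nat \<Rightarrow> 'e) set \<Rightarrow> nat \<Rightarrow> nat \<Rightarrow> 'e sft_arrow set" where
  "sft_basic A B k l =
     {(x, int k - int l, y) | x y. x \<in> A \<and> y \<in> B \<and> (shift ^^ k) x = (shift ^^ l) y}"

definition sft_groupoid_top :: "('v, 'e) pre_digraph \<Rightarrow> 'e sft_arrow topology" where
  "sft_groupoid_top D = topology_generated_by
     {sft_basic A B k l | A B k l.
        openin (sft_space D) A \<and> openin (sft_space D) B \<and> k \<ge> 1 \<and> l \<ge> 1}"

definition unit_embedding :: "(nat \<Rightarrow> 'e) \<Rightarrow> 'e sft_arrow" where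
  "unit_embedding x = (x, 0, x)"

definition sft_groupoid :: "('v, 'e) pre_digraph \<Rightarrow> 'e sft_arrow top_groupoid" where
  "sft_groupoid D =
     \<lparr>gtop = sft_groupoid_top D,
      gsrc = (\<lambda>(x, n, y). unit_embedding y),
      grng = (\<lambda>(x, n, y). unit_embedding x),
      gmul = (\<lambda>(x, n, y) (y', n', z). (x, n + n', z)),
      ginv = (\<lambda>(x, n, y). (y, - n, x))\<rparr>"

lemma topspace_sft_space: "topspace (sft_space D) = sft D"
  by (auto simp: sft_space_def sft_def)

lemma arrows_sft_groupoid:
  "arrows (sft_groupoid D) =
     {(x, n, y). x \<in> sft D \<and> y \<in> sft D \<and>
        (\<exists>k\<ge>1. \<exists>l\<ge>1. n = int k - int l \<and> (shift ^^ k) x = (shift ^^ l) y)}"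
    (is "_ = ?R")
proof
  show "arrows (sft_groupoid D) \<subseteq> ?R"
    using openin_subset[of "sft_space D"]
    by (fastforce simp: arrows_def sft_groupoid_def sft_groupoid_top_def
        topology_generated_by_topspace sft_basic_def topspace_sft_space)
  have top: "openin (sft_space D) (sft D)"
    using openin_topspace[of "sft_space D"] by (simp add: topspace_sft_space)
  show "?R \<subseteq> arrows (sft_groupoid D)"
  proof clarify
    fix x n y and k l :: nat
    assume "x \<in> sft D" "y \<in> sft D" "1 \<le> k" "1 \<le> l" "(shift ^^ k) x = (shift ^^ l) y"
    then have "(x, int k - int l, y) \<in> sft_basic (sft D) (sft D) k l"
      by (auto simp: sft_basic_def)
    then show "(x, int k - int l, y) \<in> arrows (sft_groupoid D)"
      using top \<open>1 \<le> k\<close> \<open>1 \<le> l\<close>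
      unfolding arrows_def sft_groupoid_def sft_groupoid_top_def
      by (simp add: topology_generated_by_topspace) blast
  qed
qed

end

theory Submission
  imports Defs "Graph_Theory.Arc_Walk" "HOL-Library.Omega_Words_Fun"
begin

text \<open>
  Arrows are exchanges of an initial word: for words \<open>v\<close>, \<open>w\<close> ending at the same vertex, the arrows from
  \<open>w z\<close> to \<open>v z\<close> form a compact open \<open>G\<close>-set, and these sets are a base of the topology. All
  topological properties of the groupoid follow from this base, and they pass to reductions by open
  sets of units. By irreducibility every finite word can be continued so as to end in any given
  point, which gives minimality. Since the matrix is not a permutation matrix, some vertex carries
  two loops with different first arcs; they generate infinitely many pairwise incomparable words, so
  every cylinder set contains infinitely many disjoint cylinder sets with a prescribed end vertex,
  and any clopen set can be moved into itself twice with disjoint images.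
\<close>

section \<open>Reductions of etale groupoids\<close>

text \<open>An arrow of lag \<open>n\<close> has no preferred pair of exponents: with
  \<open>(k, l)\<close>, every larger pair of the same difference describes it as well. Two
  neighbourhoods of an arrow, or two arrows to be multiplied, usually come with different pairs.
  Facts about exponents are therefore stated for all sufficiently large \<open>k\<close>; such facts
  can be combined, and common exponents can then be chosen. The possible continuations of a nonempty
  word depend only on its end vertex, so a word is exchanged for one with the same end vertex.
  Cutting a clopen set into cylinder sets produces words with various end vertices, and their
  replacements must be disjoint across these vertices too. Permutation matrices have to be excluded:
  an irreducible one describes a single cycle, so the shift is finite, and counting forbids two
  injections of a nonempty clopen set into itself with disjoint images.\<close>

lemma reduction_simps [simp]:
  "gsrc (reduction G Y) = gsrc G" "grng (reduction G Y) = grng G"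
  "gmul (reduction G Y) = gmul G" "ginv (reduction G Y) = ginv G"
  "gtop (reduction G Y) = subtopology (gtop G) {g \<in> arrows G. grng G g \<in> Y \<and> gsrc G g \<in> Y}"
  by (simp_all add: reduction_def)

lemma arrows_reduction: "arrows (reduction G Y) = {g \<in> arrows G. grng G g \<in> Y \<and> gsrc G g \<in> Y}"
  by (auto simp: arrows_def)

context groupoid
begin

lemma
  assumes "y \<in> units G"
  shows unit_in_arrows: "y \<in> arrows G"
    and src_unit: "gsrc G y = y"
    and rng_unit: "grng G y = y"
  using assms by (auto simp: units_def src_closed src_src rng_src)

lemma src_in_units: "g \<in> arrows G \<Longrightarrow> gsrc G g \<in> units G"
  by (simp add: units_def)

lemma units_reduction:
  assumes "Y \<subseteq> units G"
  shows "units (reduction G Y) = Y"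
proof
  show "units (reduction G Y) \<subseteq> Y"
    by (auto simp: units_def arrows_reduction)
  have "y \<in> units (reduction G Y)" if "y \<in> Y" for y
    using that assms unit_in_arrows[of y] src_unit[of y] rng_unit[of y]
    by (auto simp: units_def[of "reduction G Y"] arrows_reduction intro!: image_eqI[of _ _ y])
  then show "Y \<subseteq> units (reduction G Y)"
    by blast
qed

lemma unit_space_reduction:
  assumes "Y \<subseteq> units G"
  shows "unit_space (reduction G Y) = subtopology (unit_space G) Y"
proof -
  have "{g \<in> arrows G. grng G g \<in> Y \<and> gsrc G g \<in> Y} \<inter> Y = units G \<inter> Y"
    using assms unit_in_arrows src_unit rng_unit by auto
  then show ?thesis
    using assms by (simp add: unit_space_def units_reduction subtopology_subtopology)
qed

lemma groupoid_reduction: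
  assumes "Y \<subseteq> units G"
  shows "groupoid (reduction G Y)"
proof -
  have comp: "(g, h) \<in> composable G"
    if "(g, h) \<in> composable (reduction G Y)" for g h
    using that by (auto simp: composable_def arrows_reduction)
  have Y: "y \<in> arrows G" "gsrc G y = y" "grng G y = y" if "y \<in> Y" for y
    using that assms unit_in_arrows src_unit rng_unit by auto
  show ?thesis
  proof
    fix g h
    assume gh: "(g, h) \<in> composable (reduction G Y)"
    then show "gmul (reduction G Y) g h \<in> arrows (reduction G Y)"
      using comp[OF gh] mul_closed src_mul rng_mul
      by (auto simp: arrows_reduction composable_def)
  qed (auto simp: arrows_reduction Y comp src_mul rng_mul mul_assoc src_src rng_src src_rng rng_rng
      mul_src rng_mul_left inv_closed src_inv rng_inv mul_inv inv_mul)
qed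

end

lemma (in topological_groupoid) topological_groupoid_reduction:
  assumes "Y \<subseteq> units G"
  shows "topological_groupoid (reduction G Y)"
proof -
  interpret R: groupoid "reduction G Y"
    by (rule groupoid_reduction[OF assms])
  let ?A = "{g \<in> arrows G. grng G g \<in> Y \<and> gsrc G g \<in> Y}"
  have comp: "composable (reduction G Y) = (?A \<times> ?A) \<inter> composable G"
    by (auto simp: composable_def arrows_reduction)
  show ?thesis
  proof
    have "continuous_map (subtopology (prod_topology (gtop G) (gtop G)) (composable (reduction G Y)))
        (gtop G) (\<lambda>(g, h). gmul G g h)"
      by (rule continuous_map_from_subtopology_mono[OF continuous_mul]) (simp add: comp)
    then have "continuous_map (subtopology (prod_topology (gtop G) (gtop G)) (composable (reduction G Y)))
        (gtop (reduction G Y)) (\<lambda>(g, h). gmul G g h)"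
      using R.mul_closed by (auto simp: continuous_map_in_subtopology arrows_reduction)
    then show "continuous_map
        (subtopology (prod_topology (gtop (reduction G Y)) (gtop (reduction G Y)))
          (composable (reduction G Y)))
        (gtop (reduction G Y)) (\<lambda>(g, h). gmul (reduction G Y) g h)"
      by (simp add: subtopology_Times[symmetric] subtopology_subtopology comp Int_assoc[symmetric])
    have "continuous_map (gtop (reduction G Y)) (gtop G) (ginv G)"
      using continuous_inv by (simp add: continuous_map_from_subtopology)
    then show "continuous_map (gtop (reduction G Y)) (gtop (reduction G Y)) (ginv (reduction G Y))"
      using R.inv_closed by (auto simp: continuous_map_in_subtopology arrows_reduction arrows_def)
  qed
qed

section \<open>Restriction of local homeomorphisms and the etale property\<close>

lemma local_homeomorphism_imp_continuous_map:
  assumes "local_homeomorphism X Y f"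
  shows "continuous_map X Y f"
  unfolding continuous_map_def
proof (intro conjI Pi_I allI impI)
  fix x
  assume "x \<in> topspace X"
  then show "f x \<in> topspace Y"
    using assms openin_subset unfolding local_homeomorphism_def by blast
next
  fix V
  assume V: "openin Y V"
  have "\<exists>W. openin X W \<and> x \<in> W \<and> W \<subseteq> {x \<in> topspace X. f x \<in> V}"
    if x: "x \<in> topspace X" "f x \<in> V" for x
  proof -
    obtain U where U: "openin X U" "x \<in> U"
        "homeomorphic_map (subtopology X U) (subtopology Y (f ` U)) f"
      using assms x unfolding local_homeomorphism_def by blast
    then have "continuous_map (subtopology X U) Y f"
      using homeomorphic_imp_continuous_map continuous_map_in_subtopology by blast
    then have "openin (subtopology X U) {x \<in> topspace (subtopology X U). f x \<in> V}"
      using openin_continuous_map_preimage[OF _ V] by blast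
    then have "openin X {x \<in> topspace (subtopology X U). f x \<in> V}"
      using U openin_trans_full by blast
    then show ?thesis
      using U x by (intro exI[of _ "{x \<in> topspace (subtopology X U). f x \<in> V}"]) auto
  qed
  then show "openin X {x \<in> topspace X. f x \<in> V}"
    by (subst openin_subopen) blast
qed

lemma local_homeomorphism_subtopology:
  assumes f: "local_homeomorphism X Y f"
    and S: "openin X S" "f ` S \<subseteq> T" "T \<subseteq> topspace Y"
  shows "local_homeomorphism (subtopology X S) (subtopology Y T) f"
  unfolding local_homeomorphism_def
proof
  fix x
  assume "x \<in> topspace (subtopology X S)"
  then have "x \<in> topspace X" "x \<in> S"
    by auto
  then obtain U where U: "openin X U" "x \<in> U" "openin Y (f ` U)"
      "homeomorphic_map (subtopology X U) (subtopology Y (f ` U)) f"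
    using f unfolding local_homeomorphism_def by blast
  have US: "openin X (S \<inter> U)"
    using U S by blast
  then have "openin (subtopology X U) (S \<inter> U)"
    by (simp add: U openin_open_subtopology)
  then have "openin (subtopology Y (f ` U)) (f ` (S \<inter> U))"
    using homeomorphic_imp_open_map[OF U(4)] by (simp add: open_map_def)
  then have "openin Y (f ` (S \<inter> U))"
    using U(3) openin_trans_full by blast
  then have "openin (subtopology Y T) (f ` (S \<inter> U))"
    using S openin_subtopology_Int2[of Y "f ` (S \<inter> U)" T] by (simp add: image_subset_iff inf.absorb2)
  moreover have "homeomorphic_map (subtopology (subtopology X U) (S \<inter> U))
      (subtopology (subtopology Y (f ` U)) (f ` (S \<inter> U))) f"
    using openin_subset[OF US] openin_subset[OF \<open>openin Y (f ` (S \<inter> U))\<close>]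
    by (intro homeomorphic_map_subtopologies[OF U(4)]) auto
  then have "homeomorphic_map (subtopology (subtopology X S) (S \<inter> U))
      (subtopology (subtopology Y T) (f ` (S \<inter> U))) f"
    using S(2) by (simp add: subtopology_subtopology image_mono inf.absorb2 inf_left_commute
        flip: inf_assoc) (metis image_Int_subset inf.absorb2 inf.cobounded1 inf.coboundedI1 inf.coboundedI2 image_mono)
  ultimately show "\<exists>U. openin (subtopology X S) U \<and> x \<in> U \<and> openin (subtopology Y T) (f ` U) \<and>
      homeomorphic_map (subtopology (subtopology X S) U) (subtopology (subtopology Y T) (f ` U)) f"
    using U(2) \<open>x \<in> S\<close> US by (intro exI[of _ "S \<inter> U"]) (simp add: openin_open_subtopology S)
qed

text \<open>For open \<open>Y\<close> the arrows with both ends in \<open>Y\<close> form an open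
  subset; local compactness passes to it because the arrow space is Hausdorff.\<close>

lemma (in etale_groupoid) etale_groupoid_reduction:
  assumes "openin (unit_space G) Y"
  shows "etale_groupoid (reduction G Y)"
proof -
  let ?A = "{g \<in> arrows G. grng G g \<in> Y \<and> gsrc G g \<in> Y}"
  have Y: "Y \<subseteq> units G"
    using openin_subset[OF assms] by (simp add: unit_space_def)
  interpret R: topological_groupoid "reduction G Y"
    by (rule topological_groupoid_reduction[OF Y])
  have rng: "continuous_map (gtop G) (unit_space G) (grng G)"
    by (rule local_homeomorphism_imp_continuous_map[OF local_homeomorphism_rng])
  \<comment> \<open>The source of an arrow is the range of its inverse, so continuity of the range
    map and of inversion gives continuity of the source map.\<close>
  then have src: "continuous_map (gtop G) (unit_space G) (grng G \<circ> ginv G)"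
    by (rule continuous_map_compose[OF continuous_inv])
  have "openin (gtop G) ({g \<in> topspace (gtop G). grng G g \<in> Y} \<inter>
      {g \<in> topspace (gtop G). (grng G \<circ> ginv G) g \<in> Y})"
    by (intro openin_Int openin_continuous_map_preimage[OF rng assms]
        openin_continuous_map_preimage[OF src assms])
  also have "\<dots> = ?A"
    by (auto simp: arrows_def[symmetric] rng_inv)
  finally have A: "openin (gtop G) ?A" .
  show ?thesis
  proof
    show "second_countable (gtop (reduction G Y))"
      by (simp add: second_countable second_countable_subtopology)
    show "locally_compact_space (gtop (reduction G Y))"
      by (simp add: A Hausdorff locally_compact locally_compact_space_open_subset)
    show "Hausdorff_space (gtop (reduction G Y))"
      by (simp add: Hausdorff Hausdorff_space_subtopology)
    show "local_homeomorphism (gtop (reduction G Y)) (unit_space (reduction G Y))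
        (grng (reduction G Y))"
      unfolding reduction_simps unit_space_reduction[OF Y]
      by (rule local_homeomorphism_subtopology[OF local_homeomorphism_rng A])
        (use openin_subset[OF assms] in auto)
  qed
qed

section \<open>Words and cylinder sets\<close>

lemma shift_funpow_eq_suffix: "shift ^^ k = suffix k"
  by (induction k) (simp_all add: fun_eq_iff shift_def)

lemma build_in_sft_iff: "a ## x \<in> sft D \<longleftrightarrow> a \<in> arcs D \<and> head D a = tail D (x 0) \<and> x \<in> sft D"
  (is "?l \<longleftrightarrow> ?r")
proof
  assume ?l
  then have h: "(a ## x) k \<in> arcs D" "head D ((a ## x) k) = tail D ((a ## x) (Suc k))" for k
    by (auto simp: sft_def)
  show ?r
    using h(1)[of 0] h(2)[of 0] h(1)[of "Suc k" for k] h(2)[of "Suc k" for k]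
    by (simp add: sft_def)
next
  assume r: ?r
  have "(a ## x) k \<in> arcs D \<and> head D ((a ## x) k) = tail D ((a ## x) (Suc k))" for k
    using r by (cases k) (auto simp: sft_def)
  then show ?l
    unfolding sft_def by blast
qed

lemma prefix_eq_le:
  assumes "prefix m x = prefix m y" and "n \<le> m"
  shows "prefix n x = prefix n y"
  using arg_cong[OF assms(1), of "take n"] assms(2) by (simp add: min_absorb1)

locale finite_graph_shift = fin_digraph D for D :: "('v, 'e) pre_digraph"
begin

text \<open>The start vertex is read off \<open>w \<frown> z\<close> instead of \<open>w\<close>, so
  that the empty word is covered: its walk starts and ends at \<open>tail D (z 0)\<close>.\<close>

lemma conc_in_sft_iff:
  "w \<frown> z \<in> sft D \<longleftrightarrow> z \<in> sft D \<and> awalk (tail D ((w \<frown> z) 0)) w (tail D (z 0))"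
proof (induction w)
  case Nil
  then show ?case
    by (auto simp: awalk_Nil_iff sft_def)
next
  case (Cons a w)
  have start: "head D a = tail D ((w \<frown> z) 0)" if "awalk (head D a) w (tail D (z 0))"
    using that by (cases w) (auto simp: awalk_Nil_iff awalk_Cons_iff)
  have "(a # w) \<frown> z \<in> sft D \<longleftrightarrow>
      a \<in> arcs D \<and> head D a = tail D ((w \<frown> z) 0) \<and> w \<frown> z \<in> sft D"
    by (simp only: build_cons build_in_sft_iff)
  also have "\<dots> \<longleftrightarrow> z \<in> sft D \<and> a \<in> arcs D \<and> awalk (head D a) w (tail D (z 0))"
    using start by (metis Cons.IH)
  finally show ?case
    by (simp add: awalk_Cons_iff)
qed

text \<open>The admissible continuations of a nonempty word are determined by its end vertex. The
  empty word can be continued by every point of the shift, hence the restriction to nonempty words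
  here and in \<open>interchangeable\<close>.\<close>

lemma conc_walk_in_sft_iff:
  assumes "awalk u w v" and "w \<noteq> []"
  shows "w \<frown> z \<in> sft D \<longleftrightarrow> z \<in> sft D \<and> tail D (z 0) = v"
proof -
  have "(w \<frown> z) 0 = hd w"
    using assms(2) by (simp add: hd_conv_nth)
  moreover have "u = tail D (hd w)"
    using assms by (cases w) (auto simp: awalk_Cons_iff)
  ultimately show ?thesis
    using assms by (auto simp: conc_in_sft_iff dest: awalk_ends)
qed

section \<open>Cylinder sets and the topology of the shift\<close>

definition cylinder :: "'e list \<Rightarrow> (nat \<Rightarrow> 'e) set" where
  "cylinder w = {x \<in> sft D. prefix (length w) x = w}"

lemma cylinder_subset: "cylinder w \<subseteq> sft D"
  by (auto simp: cylinder_def)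

lemma cylinder_eq: "cylinder w = {w \<frown> z | z. w \<frown> z \<in> sft D}"
proof -
  have "\<exists>z. x = w \<frown> z" if "prefix (length w) x = w" for x
    using that prefix_suffix[of x "length w"] by metis
  then show ?thesis
    by (auto simp: cylinder_def)
qed

lemma cylinder_prefix_mono: "m \<le> n \<Longrightarrow> cylinder (prefix n x) \<subseteq> cylinder (prefix m x)"
  using prefix_eq_le by (auto simp: cylinder_def)

lemma continuous_map_sft_nth:
  "continuous_map (sft_space D) (discrete_topology (arcs D)) (\<lambda>x. x i)"
  unfolding sft_space_def
  by (intro continuous_map_from_subtopology continuous_map_product_projection) simp

lemma openin_cylinder: "openin (sft_space D) (cylinder w)"
proof (induction w rule: rev_induct)
  case Nil
  then show ?case
    using openin_topspace[of "sft_space D"] by (simp add: cylinder_def topspace_sft_space)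
next
  case (snoc a w)
  \<comment> \<open>The letter \<open>a\<close> is arbitrary. Intersecting with
    \<open>arcs D\<close> gives an open set of the discrete space in any case; if \<open>a\<close>
    is not an arc, the cylinder set is empty.\<close>
  have "openin (sft_space D) {x \<in> topspace (sft_space D). x (length w) \<in> {a} \<inter> arcs D}"
    by (rule openin_continuous_map_preimage[OF continuous_map_sft_nth]) simp
  moreover have "cylinder (w @ [a]) =
      cylinder w \<inter> {x \<in> topspace (sft_space D). x (length w) \<in> {a} \<inter> arcs D}"
    by (auto simp: cylinder_def topspace_sft_space) (auto simp: sft_def)
  ultimately show ?case
    using snoc by auto
qed

text \<open>A basic open set of the product restricts only finitely many coordinates, and every
  prefix that covers them will do.\<close>

lemma eventually_cylinder_subset:
  assumes "openin (sft_space D) A" and "x \<in> A"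
  shows "\<forall>\<^sub>F n in sequentially. cylinder (prefix n x) \<subseteq> A"
proof -
  obtain T where T: "openin (product_topology (\<lambda>_. discrete_topology (arcs D)) UNIV) T"
      "A = T \<inter> sft D"
    using assms(1) by (auto simp: sft_space_def openin_subtopology)
  then have "x \<in> T"
    using assms(2) by simp
  then obtain U where U: "finite {i. U i \<noteq> arcs D}" "x \<in> Pi\<^sub>E UNIV U" "Pi\<^sub>E UNIV U \<subseteq> T"
    using T(1)[unfolded openin_product_topology_alt] by auto
  obtain N where N: "\<And>i. U i \<noteq> arcs D \<Longrightarrow> i < N"
    using U(1) finite_nat_set_iff_bounded by auto
  have "cylinder (prefix n x) \<subseteq> A" if "n \<ge> N" for n
  proof
    fix y
    assume y: "y \<in> cylinder (prefix n x)"
    then have "prefix n y = prefix n x"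
      by (simp add: cylinder_def)
    then have eq: "y i = x i" if "i < n" for i
      using that by (metis add_0 diff_zero subsequence_nth)
    have "y i \<in> U i" for i
    proof (cases "U i = arcs D")
      case True
      then show ?thesis
        using y by (auto simp: cylinder_def sft_def)
    next
      case False
      then have "y i = x i"
        using N \<open>n \<ge> N\<close> eq by (meson order_less_le_trans)
      then show ?thesis
        using U(2) by auto
    qed
    then show "y \<in> A"
      using U(3) T(2) y cylinder_subset by blast
  qed
  then show ?thesis
    using eventually_sequentially by auto
qed

text \<open>Tychonoff's theorem for the finite alphabet: each condition on two consecutive
  coordinates is closed, being the preimage of a subset of a discrete space, and the shift is the
  intersection of these conditions.\<close>

lemma compact_space_sft: "compact_space (sft_space D)"
proof -
  let ?P = "product_topology (\<lambda>_::nat. discrete_topology (arcs D)) UNIV"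
  have cont: "continuous_map ?P (prod_topology (discrete_topology (arcs D)) (discrete_topology (arcs D)))
      (\<lambda>x. (x k, x (Suc k)))" for k
    by (intro continuous_map_pairedI continuous_map_product_projection) auto
  have "closedin ?P {x \<in> topspace ?P. (x k, x (Suc k)) \<in>
      {(e, f). e \<in> arcs D \<and> f \<in> arcs D \<and> head D e = tail D f}}" for k
    by (rule closedin_continuous_map_preimage[OF cont])
      (auto simp: prod_topology_discrete_topology[symmetric])
  then have "closedin ?P (\<Inter>k. {x \<in> topspace ?P. (x k, x (Suc k)) \<in>
      {(e, f). e \<in> arcs D \<and> f \<in> arcs D \<and> head D e = tail D f}})"
    by (intro closedin_Inter) auto
  moreover have "(\<Inter>k. {x \<in> topspace ?P. (x k, x (Suc k)) \<in>
      {(e, f). e \<in> arcs D \<and> f \<in> arcs D \<and> head D e = tail D f}}) = sft D"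
    by (auto simp: sft_def)
  moreover have "compact_space ?P"
    by (auto simp: compact_space_product_topology compact_space_discrete_topology)
  ultimately show ?thesis
    by (simp add: sft_space_def closedin_compact_space compact_space_subtopology)
qed

lemma Hausdorff_space_sft: "Hausdorff_space (sft_space D)"
  unfolding sft_space_def
  by (intro Hausdorff_space_subtopology) (simp add: Hausdorff_space_product_topology)

text \<open>The other words of the same length cover the complement by open cylinder sets, so a
  cylinder set is closed in a compact space.\<close>

lemma compactin_cylinder: "compactin (sft_space D) (cylinder w)"
proof -
  have "sft D - cylinder w = (\<Union>v \<in> {v. length v = length w \<and> v \<noteq> w}. cylinder v)"
    by (auto simp: cylinder_def)
  then have "openin (sft_space D) (sft D - cylinder w)"
    using openin_cylinder by auto
  then have "closedin (sft_space D) (cylinder w)"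
    using cylinder_subset by (auto simp: closedin_def topspace_sft_space)
  then show ?thesis
    by (simp add: closedin_compact_space compact_space_sft)
qed

text \<open>
  The cylinder sets of two such words are identified by exchanging the initial word, and the arrows
  that do so form a compact open \<open>G\<close>-set.
\<close>

definition interchangeable :: "'e list \<Rightarrow> 'e list \<Rightarrow> bool" where
  "interchangeable v w \<longleftrightarrow> v \<noteq> [] \<and> w \<noteq> [] \<and> (\<forall>z. v \<frown> z \<in> sft D \<longleftrightarrow> w \<frown> z \<in> sft D)"

definition bisection :: "'e list \<Rightarrow> 'e list \<Rightarrow> 'e sft_arrow set" where
  "bisection v w =
     {(v \<frown> z, int (length v) - int (length w), w \<frown> z) | z. v \<frown> z \<in> sft D \<and> w \<frown> z \<in> sft D}"

section \<open>Exchange of initial words\<close>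

lemma walks_interchangeable:
  assumes "awalk u v \<xi>" "awalk u' w \<xi>" "v \<noteq> []" "w \<noteq> []"
  shows "interchangeable v w"
  using assms by (simp add: interchangeable_def conc_walk_in_sft_iff)

lemma awalk_prefix:
  assumes "x \<in> sft D"
  shows "awalk (tail D (x 0)) (prefix k x) (tail D (x k))"
proof -
  have "prefix k x \<frown> suffix k x \<in> sft D"
    using assms by simp
  then show ?thesis
    by (subst (asm) conc_in_sft_iff) simp
qed

text \<open>Equal tails begin with the same arc, so both prefixes end at the tail of that
  arc.\<close>

lemma prefixes_interchangeable:
  assumes "x \<in> sft D" "y \<in> sft D" "suffix k x = suffix l y" "k \<ge> 1" "l \<ge> 1"
  shows "interchangeable (prefix k x) (prefix l y)"
proof -
  have "x k = y l"
    using assms(3) by (metis add.right_neutral suffix_nth)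
  then show ?thesis
    using awalk_prefix[OF assms(1), of k] awalk_prefix[OF assms(2), of l] assms(4,5)
    by (intro walks_interchangeable) auto
qed

text \<open>With the word lengths as exponents, the equation between the shifted points says that
  both words are followed by the same \<open>z\<close>. For nonempty words this exhibits a bisection
  as one of the generating open sets.\<close>

lemma bisection_eq_sft_basic:
  "bisection v w = sft_basic (cylinder v) (cylinder w) (length v) (length w)"
proof
  show "bisection v w \<subseteq> sft_basic (cylinder v) (cylinder w) (length v) (length w)"
    unfolding bisection_def sft_basic_def shift_funpow_eq_suffix
    by clarify (intro exI conjI, rule refl, simp_all add: cylinder_def)
  show "sft_basic (cylinder v) (cylinder w) (length v) (length w) \<subseteq> bisection v w"
  proof
    fix p
    assume "p \<in> sft_basic (cylinder v) (cylinder w) (length v) (length w)"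
    then obtain x y where p: "p = (x, int (length v) - int (length w), y)"
        and xy: "x \<in> cylinder v" "y \<in> cylinder w" "suffix (length v) x = suffix (length w) y"
      unfolding sft_basic_def shift_funpow_eq_suffix by blast
    obtain z z' where z: "x = v \<frown> z" "y = w \<frown> z'" "v \<frown> z \<in> sft D" "w \<frown> z' \<in> sft D"
      using xy(1,2) by (auto simp only: cylinder_eq mem_Collect_eq)
    then have "z = z'"
      using xy(3) by simp
    then show "p \<in> bisection v w"
      using p z by (auto simp only: bisection_def mem_Collect_eq)
  qed
qed

lemma fst_bisection:
  assumes "interchangeable v w"
  shows "fst ` bisection v w = cylinder v"
proof -
  have "{v \<frown> z | z. v \<frown> z \<in> sft D} \<subseteq> fst ` bisection v w"
    using assms by (auto simp: bisection_def interchangeable_def image_iff)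
  then show ?thesis
    by (auto simp: cylinder_eq bisection_def)
qed

lemma mem_bisection_prefix:
  assumes "x \<in> sft D" "y \<in> sft D" "suffix k x = suffix l y" "n = int k - int l"
  shows "(x, n, y) \<in> bisection (prefix k x) (prefix l y)"
proof -
  have "x = prefix k x \<frown> suffix k x"
    by simp
  moreover have "y = prefix l y \<frown> suffix k x"
    unfolding assms(3) by simp
  ultimately show ?thesis
    using assms(1,2,4) unfolding bisection_def
    by (metis (mono_tags, lifting) diff_zero mem_Collect_eq subsequence_length)
qed

text \<open>The words and the lag are fixed, and either end of an arrow determines the common tail
  \<open>z\<close>; this is what makes bisections into \<open>G\<close>-sets.\<close>

lemma inj_on_bisection:
  "inj_on fst (bisection v w)" "inj_on (snd \<circ> snd) (bisection v w)"
  by (auto simp: bisection_def inj_on_def)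

end

section \<open>The groupoid of a shift of finite type\<close>

lemma sft_groupoid_simps [simp]:
  "gtop (sft_groupoid D) = sft_groupoid_top D"
  "gsrc (sft_groupoid D) (x, n, y) = unit_embedding y"
  "grng (sft_groupoid D) (x, n, y) = unit_embedding x"
  "gmul (sft_groupoid D) (x, n, y) (y', m, z) = (x, n + m, z)"
  "ginv (sft_groupoid D) (x, n, y) = (y, - n, x)"
  by (simp_all add: sft_groupoid_def)

lemma fst_unit_embedding [simp]: "fst (unit_embedding x) = x"
  by (simp add: unit_embedding_def)

lemma inj_unit_embedding: "inj unit_embedding"
  by (auto simp: inj_def unit_embedding_def)

lemma unit_embedding_eq_iff [simp]: "unit_embedding x = unit_embedding y \<longleftrightarrow> x = y"
  by (auto simp: unit_embedding_def)

lemma topspace_sft_groupoid_top: "topspace (sft_groupoid_top D) = arrows (sft_groupoid D)"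
  by (simp add: arrows_def)

text \<open>One more shift on both sides makes the exponents positive without changing their
  difference, so exponent 0 is allowed here.\<close>

lemma arrow_sft_groupoidI:
  assumes "x \<in> sft D" "y \<in> sft D" "suffix k x = suffix l y" "n = int k - int l"
  shows "(x, n, y) \<in> arrows (sft_groupoid D)"
proof -
  have "suffix (Suc k) x = suffix (Suc l) y"
    using arg_cong[OF assms(3), of "suffix 1"] by simp
  moreover have "n = int (Suc k) - int (Suc l)" "1 \<le> Suc k" "1 \<le> Suc l"
    using assms(4) by auto
  ultimately show ?thesis
    using assms(1,2) unfolding arrows_sft_groupoid shift_funpow_eq_suffix by blast
qed

lemma arrow_sft_groupoidD:
  assumes "(x, n, y) \<in> arrows (sft_groupoid D)"
  shows "x \<in> sft D" "y \<in> sft D"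
  using assms by (auto simp: arrows_sft_groupoid)

text \<open>Shifting both sides further preserves the lag. The bound \<open>N\<close> lets the
  second exponent be matched with the first exponent of a composable arrow.\<close>

lemma eventually_arrow_exponents:
  assumes "(x, n, y) \<in> arrows (sft_groupoid D)"
  shows "\<forall>\<^sub>F k in sequentially. k \<ge> 1 \<and> (\<exists>l\<ge>N. l \<ge> 1 \<and> n = int k - int l \<and> suffix k x = suffix l y)"
proof -
  obtain a b where ab: "n = int a - int b" "suffix a x = suffix b y"
    using assms by (auto simp: arrows_sft_groupoid shift_funpow_eq_suffix)
  have "k \<ge> 1 \<and> (\<exists>l\<ge>N. l \<ge> 1 \<and> n = int k - int l \<and> suffix k x = suffix l y)"
    if k: "k \<ge> a + N + 1" for k
  proof -
    have "suffix (a + (k - a)) x = suffix (b + (k - a)) y"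
      using arg_cong[OF ab(2), of "suffix (k - a)"] by simp
    then show ?thesis
      using k ab(1) by (intro conjI exI[of _ "b + (k - a)"]) auto
  qed
  then show ?thesis
    using eventually_sequentially by blast
qed

lemma mem_units_sft_groupoid_iff:
  "g \<in> units (sft_groupoid D) \<longleftrightarrow> (\<exists>x \<in> sft D. g = unit_embedding x)"
proof
  show "\<exists>x \<in> sft D. g = unit_embedding x" if "g \<in> units (sft_groupoid D)"
    using that by (auto simp: units_def dest: arrow_sft_groupoidD)
next
  assume "\<exists>x \<in> sft D. g = unit_embedding x"
  then obtain x where x: "x \<in> sft D" "g = unit_embedding x"
    by blast
  then have "(x, 0, x) \<in> arrows (sft_groupoid D)"
    using arrow_sft_groupoidI[of x D x 0 0 0] by simp
  then show "g \<in> units (sft_groupoid D)"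
    unfolding units_def x(2) by (rule rev_image_eqI) simp
qed

lemma units_sft_groupoid: "units (sft_groupoid D) = unit_embedding ` sft D"
  using mem_units_sft_groupoid_iff by blast

lemma groupoid_sft_groupoid: "groupoid (sft_groupoid D)"
proof
  fix g assume "g \<in> arrows (sft_groupoid D)"
  moreover obtain x n y where g: "g = (x, n, y)"
    by (cases g)
  ultimately have xy: "x \<in> sft D" "y \<in> sft D" and arr: "(x, n, y) \<in> arrows (sft_groupoid D)"
    using arrow_sft_groupoidD by auto
  obtain k l where kl: "n = int k - int l" "suffix k x = suffix l y"
    using arr by (auto simp: arrows_sft_groupoid shift_funpow_eq_suffix)
  show "ginv (sft_groupoid D) g \<in> arrows (sft_groupoid D)"
    using xy kl by (auto simp: g intro!: arrow_sft_groupoidI[of _ _ _ l k])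
  show "gsrc (sft_groupoid D) g \<in> arrows (sft_groupoid D)"
    "grng (sft_groupoid D) g \<in> arrows (sft_groupoid D)"
    using xy by (auto simp: g unit_embedding_def intro!: arrow_sft_groupoidI[of _ _ _ 0 0])
  show "gsrc (sft_groupoid D) (gsrc (sft_groupoid D) g) = gsrc (sft_groupoid D) g"
    "grng (sft_groupoid D) (gsrc (sft_groupoid D) g) = gsrc (sft_groupoid D) g"
    "gsrc (sft_groupoid D) (grng (sft_groupoid D) g) = grng (sft_groupoid D) g"
    "grng (sft_groupoid D) (grng (sft_groupoid D) g) = grng (sft_groupoid D) g"
    "gmul (sft_groupoid D) g (gsrc (sft_groupoid D) g) = g"
    "gmul (sft_groupoid D) (grng (sft_groupoid D) g) g = g"
    "gsrc (sft_groupoid D) (ginv (sft_groupoid D) g) = grng (sft_groupoid D) g"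
    "grng (sft_groupoid D) (ginv (sft_groupoid D) g) = gsrc (sft_groupoid D) g"
    "gmul (sft_groupoid D) g (ginv (sft_groupoid D) g) = grng (sft_groupoid D) g"
    "gmul (sft_groupoid D) (ginv (sft_groupoid D) g) g = gsrc (sft_groupoid D) g"
    by (simp_all add: g unit_embedding_def)
next
  fix g h assume gh: "(g, h) \<in> composable (sft_groupoid D)"
  then obtain x n y m z where g: "g = (x, n, y)" "h = (y, m, z)"
    by (cases g, cases h) (auto simp: composable_def)
  then have arr: "(x, n, y) \<in> arrows (sft_groupoid D)" "(y, m, z) \<in> arrows (sft_groupoid D)"
    using gh by (auto simp: composable_def)
  \<comment> \<open>The two tail equations must meet at the same shift of \<open>y\<close>. The
    second arrow can be described with any first exponent beyond \<open>N\<close>, and the second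
    exponent of the first arrow is then chosen in that range.\<close>
  obtain N where N: "\<And>k. k \<ge> N \<Longrightarrow> \<exists>l. m = int k - int l \<and> suffix k y = suffix l z"
    using eventually_arrow_exponents[OF arr(2), of 0] unfolding eventually_sequentially by meson
  obtain k l where "n = int k - int l" "suffix k x = suffix l y" "l \<ge> N"
    using eventually_happens'[OF sequentially_bot eventually_arrow_exponents[OF arr(1), of N]] by blast
  then show "gmul (sft_groupoid D) g h \<in> arrows (sft_groupoid D)"
    using N[of l] arrow_sft_groupoidD[OF arr(1)] arrow_sft_groupoidD[OF arr(2)]
    by (auto simp: g intro!: arrow_sft_groupoidI)
  show "gsrc (sft_groupoid D) (gmul (sft_groupoid D) g h) = gsrc (sft_groupoid D) h"
    "grng (sft_groupoid D) (gmul (sft_groupoid D) g h) = grng (sft_groupoid D) g"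
    by (simp_all add: g)
  show "gmul (sft_groupoid D) (gmul (sft_groupoid D) g h) k =
      gmul (sft_groupoid D) g (gmul (sft_groupoid D) h k)" for k
    by (cases k) (simp add: g)
qed

context finite_graph_shift
begin

section \<open>Bisections as a base of the arrow space\<close>

lemma openin_sft_basic:
  assumes "openin (sft_space D) A" "openin (sft_space D) B" "k \<ge> 1" "l \<ge> 1"
  shows "openin (sft_groupoid_top D) (sft_basic A B k l)"
  unfolding sft_groupoid_top_def using assms by (intro topology_generated_by_Basis) blast

lemma openin_bisection:
  "v \<noteq> [] \<Longrightarrow> w \<noteq> [] \<Longrightarrow> openin (sft_groupoid_top D) (bisection v w)"
  unfolding bisection_eq_sft_basic
  by (intro openin_sft_basic openin_cylinder) (simp_all add: Suc_le_eq)

text \<open>Long prefixes force the ends into \<open>A\<close> and \<open>B\<close>. They also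
  preserve the tail equation, because \<open>x\<close> after \<open>a\<close> and \<open>y\<close>
  after \<open>b\<close> agree up to the exchanged tail.\<close>

lemma eventually_bisection_subset_sft_basic:
  assumes A: "openin (sft_space D) A" and B: "openin (sft_space D) B"
    and g: "(x, n, y) \<in> sft_basic A B a b"
  shows "\<forall>\<^sub>F k in sequentially. \<forall>l. n = int k - int l \<longrightarrow>
    bisection (prefix k x) (prefix l y) \<subseteq> sft_basic A B a b"
proof -
  have xy: "x \<in> A" "y \<in> B" "n = int a - int b" "suffix a x = suffix b y"
    using g by (auto simp: sft_basic_def shift_funpow_eq_suffix)
  obtain K where K: "\<And>k. k \<ge> K \<Longrightarrow> cylinder (prefix k x) \<subseteq> A"
    using eventually_cylinder_subset[OF A xy(1)] by (auto simp: eventually_sequentially)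
  obtain L where L: "\<And>l. l \<ge> L \<Longrightarrow> cylinder (prefix l y) \<subseteq> B"
    using eventually_cylinder_subset[OF B xy(2)] by (auto simp: eventually_sequentially)
  have "bisection (prefix k x) (prefix l y) \<subseteq> sft_basic A B a b"
    \<comment> \<open>Since \<open>l = k - n\<close>, the summand \<open>nat \<bar>n\<bar>\<close>
      secures \<open>l \<ge> L\<close>; \<open>k \<ge> a\<close> yields \<open>l \<ge> b\<close>
      because both pairs have difference \<open>n\<close>.\<close>
    if k: "k \<ge> K + L + a + nat \<bar>n\<bar>" and l: "n = int k - int l" for k l
  proof
    fix p
    assume "p \<in> bisection (prefix k x) (prefix l y)"
    then obtain z where p: "p = (prefix k x \<frown> z, n, prefix l y \<frown> z)"
        and z: "prefix k x \<frown> z \<in> sft D" "prefix l y \<frown> z \<in> sft D"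
      using l by (auto simp: bisection_def)
    have kl: "k \<ge> a" "l \<ge> b" "k - a = l - b" "k \<ge> K" "l \<ge> L"
      using k l xy(3) by auto
    have "x [a \<rightarrow> k] = y [b \<rightarrow> l]"
      using kl(3) xy(4) by (metis subsequence_prefix_suffix)
    then have "suffix a (prefix k x \<frown> z) = suffix b (prefix l y \<frown> z)"
      using kl by simp
    moreover have "prefix k x \<frown> z \<in> A" "prefix l y \<frown> z \<in> B"
      using z K[OF kl(4)] L[OF kl(5)] by (auto simp: cylinder_def)
    ultimately show "p \<in> sft_basic A B a b"
      using p xy(3) unfolding sft_basic_def shift_funpow_eq_suffix by blast
  qed
  then show ?thesis
    unfolding eventually_sequentially by blast
qed

text \<open>Induction over the generated topology. The two thresholds arising from a finite
  intersection are absorbed by the filter; a statement about a single \<open>k\<close> would not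
  survive this case.\<close>

lemma eventually_bisection_subset:
  assumes "openin (sft_groupoid_top D) U" and "(x, n, y) \<in> U"
  shows "\<forall>\<^sub>F k in sequentially. \<forall>l. n = int k - int l \<longrightarrow>
    bisection (prefix k x) (prefix l y) \<subseteq> U"
proof -
  have "generate_topology_on {sft_basic A B k l | A B k l.
      openin (sft_space D) A \<and> openin (sft_space D) B \<and> k \<ge> 1 \<and> l \<ge> 1} U"
    using assms(1) unfolding sft_groupoid_top_def by (rule openin_topology_generated_by)
  then show ?thesis
    using assms(2)
  proof induction
    case Empty
    then show ?case by simp
  next
    case (Int a b)
    then have "\<forall>\<^sub>F k in sequentially. \<forall>l. n = int k - int l \<longrightarrow> bisection (prefix k x) (prefix l y) \<subseteq> a"
      "\<forall>\<^sub>F k in sequentially. \<forall>l. n = int k - int l \<longrightarrow> bisection (prefix k x) (prefix l y) \<subseteq> b"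
      by blast+
    then show ?case
      by eventually_elim blast
  next
    case (UN K)
    then obtain V where V: "V \<in> K" "\<forall>\<^sub>F k in sequentially. \<forall>l. n = int k - int l \<longrightarrow>
        bisection (prefix k x) (prefix l y) \<subseteq> V"
      by blast
    from V(2) show ?case
      by eventually_elim (use V(1) in blast)
  next
    case (Basis s)
    then show ?case
      using eventually_bisection_subset_sft_basic by blast
  qed
qed

text \<open>Large exponents serve two purposes at once: the bisection fits into \<open>U\<close>,
  and its exponents are positive and describe the given arrow.\<close>

lemma openin_sft_groupoidE:
  assumes U: "openin (sft_groupoid_top D) U" "(x, n, y) \<in> U"
  obtains k l where "interchangeable (prefix k x) (prefix l y)"
    "bisection (prefix k x) (prefix l y) \<subseteq> U" "(x, n, y) \<in> bisection (prefix k x) (prefix l y)"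
proof -
  have g: "(x, n, y) \<in> arrows (sft_groupoid D)"
    using openin_subset[OF U(1)] U(2) by (auto simp: topspace_sft_groupoid_top)
  note xy = arrow_sft_groupoidD[OF g]
  obtain k l where "bisection (prefix k x) (prefix l y) \<subseteq> U"
      and kl: "k \<ge> 1" "l \<ge> 1" "n = int k - int l" "suffix k x = suffix l y"
    using eventually_happens'[OF sequentially_bot
        eventually_conj[OF eventually_bisection_subset[OF U] eventually_arrow_exponents[OF g, of 0]]]
    by blast
  then show ?thesis
    using that prefixes_interchangeable[OF xy kl(4,1,2)] mem_bisection_prefix[OF xy kl(4,3)] by blast
qed

section \<open>End points of arrows and the unit space\<close>

lemma continuous_map_fst_sft_groupoid:
  "continuous_map (sft_groupoid_top D) (sft_space D) fst"
  and continuous_map_snd_sft_groupoid: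
  "continuous_map (sft_groupoid_top D) (sft_space D) (snd \<circ> snd)"
proof -
  have top: "openin (sft_space D) (sft D)"
    using openin_topspace[of "sft_space D"] by (simp add: topspace_sft_space)
  have eq: "{g \<in> topspace (sft_groupoid_top D). fst g \<in> A} =
        (\<Union>k\<in>{1..}. \<Union>l\<in>{1..}. sft_basic A (sft D) k l)"
      "{g \<in> topspace (sft_groupoid_top D). (snd \<circ> snd) g \<in> A} =
        (\<Union>k\<in>{1..}. \<Union>l\<in>{1..}. sft_basic (sft D) A k l)"
    if "openin (sft_space D) A" for A
    using openin_subset[OF that]
    by (auto simp: topspace_sft_space topspace_sft_groupoid_top arrows_sft_groupoid sft_basic_def)
  have maps: "fst \<in> topspace (sft_groupoid_top D) \<rightarrow> topspace (sft_space D)"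
      "snd \<circ> snd \<in> topspace (sft_groupoid_top D) \<rightarrow> topspace (sft_space D)"
    by (auto simp: topspace_sft_groupoid_top topspace_sft_space dest: arrow_sft_groupoidD)
  show "continuous_map (sft_groupoid_top D) (sft_space D) fst"
    unfolding continuous_map_def
    using maps by (auto simp only: eq atLeast_iff intro!: openin_Union openin_sft_basic top)
  show "continuous_map (sft_groupoid_top D) (sft_space D) (snd \<circ> snd)"
    unfolding continuous_map_def
    using maps by (auto simp only: eq atLeast_iff intro!: openin_Union openin_sft_basic top)
qed

text \<open>The bisections inside \<open>U\<close> project onto whole cylinder sets, and these are
  open.\<close>

lemma open_map_fst_sft_groupoid: "open_map (sft_groupoid_top D) (sft_space D) fst"
  unfolding open_map_def
proof (intro allI impI)
  fix U
  assume U: "openin (sft_groupoid_top D) U"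
  have "\<exists>C. openin (sft_space D) C \<and> x \<in> C \<and> C \<subseteq> fst ` U" if g: "(x, n, y) \<in> U" for x n y
  proof -
    obtain k l where vw: "interchangeable (prefix k x) (prefix l y)"
        "bisection (prefix k x) (prefix l y) \<subseteq> U" "(x, n, y) \<in> bisection (prefix k x) (prefix l y)"
      by (rule openin_sft_groupoidE[OF U g])
    have "x \<in> fst ` bisection (prefix k x) (prefix l y)"
      using vw(3) by (rule rev_image_eqI) simp
    then have "x \<in> cylinder (prefix k x)" "cylinder (prefix k x) \<subseteq> fst ` U"
      using image_mono[OF vw(2), of fst] fst_bisection[OF vw(1)] by simp_all
    then show ?thesis
      using openin_cylinder by blast
  qed
  then have "\<forall>x \<in> fst ` U. \<exists>C. openin (sft_space D) C \<and> x \<in> C \<and> C \<subseteq> fst ` U"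
    by auto
  then show "openin (sft_space D) (fst ` U)"
    by (rule openin_subopen[THEN iffD2])
qed

text \<open>A unit has lag 0, so it meets a generating set only if \<open>k = l\<close>; the tail
  equation then holds trivially and the preimage is \<open>A \<inter> B\<close>.\<close>

lemma continuous_map_unit_embedding:
  "continuous_map (sft_space D) (sft_groupoid_top D) unit_embedding"
  unfolding sft_groupoid_top_def
proof (rule continuous_on_generated_topo)
  fix U
  assume "U \<in> {sft_basic A B k l | A B k l.
      openin (sft_space D) A \<and> openin (sft_space D) B \<and> k \<ge> 1 \<and> l \<ge> 1}"
  then obtain A B k l where U: "U = sft_basic A B k l"
      and AB: "openin (sft_space D) A" "openin (sft_space D) B"
    by blast
  then have "unit_embedding -` U \<inter> topspace (sft_space D) = (if k = l then A \<inter> B else {})"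
    using openin_subset[OF AB(1)] by (auto simp: sft_basic_def unit_embedding_def)
  then show "openin (sft_space D) (unit_embedding -` U \<inter> topspace (sft_space D))"
    using AB by auto
next
  show "unit_embedding ` topspace (sft_space D) \<subseteq> \<Union> {sft_basic A B k l | A B k l.
      openin (sft_space D) A \<and> openin (sft_space D) B \<and> k \<ge> 1 \<and> l \<ge> 1}"
    unfolding topology_generated_by_topspace[symmetric] sft_groupoid_top_def[symmetric]
      topspace_sft_groupoid_top topspace_sft_space units_sft_groupoid[symmetric]
    using groupoid.unit_in_arrows[OF groupoid_sft_groupoid] by blast
qed

lemma unit_space_sft_groupoid:
  "unit_space (sft_groupoid D) = subtopology (sft_groupoid_top D) (unit_embedding ` sft D)"
  by (simp add: unit_space_def units_sft_groupoid)

lemma homeomorphic_map_unit_embedding: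
  "homeomorphic_map (sft_space D) (unit_space (sft_groupoid D)) unit_embedding"
proof -
  have "homeomorphic_maps (sft_space D) (unit_space (sft_groupoid D)) unit_embedding fst"
    unfolding homeomorphic_maps_def unit_space_sft_groupoid
  proof (intro conjI)
    show "continuous_map (sft_space D)
        (subtopology (sft_groupoid_top D) (unit_embedding ` sft D)) unit_embedding"
      by (intro continuous_map_into_subtopology continuous_map_unit_embedding)
        (simp add: topspace_sft_space)
    show "continuous_map (subtopology (sft_groupoid_top D) (unit_embedding ` sft D)) (sft_space D) fst"
      by (intro continuous_map_from_subtopology continuous_map_fst_sft_groupoid)
  qed auto
  then show ?thesis
    using homeomorphic_map_maps by blast
qed

lemma homeomorphic_map_fst_bisection:
  assumes "interchangeable v w"
  shows "homeomorphic_map (subtopology (sft_groupoid_top D) (bisection v w))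
    (subtopology (sft_space D) (cylinder v)) fst"
proof (rule bijective_open_imp_homeomorphic_map)
  have op: "openin (sft_groupoid_top D) (bisection v w)"
    using assms openin_bisection by (simp add: interchangeable_def)
  then have sub: "bisection v w \<subseteq> topspace (sft_groupoid_top D)"
    by (rule openin_subset)
  show "continuous_map (subtopology (sft_groupoid_top D) (bisection v w))
      (subtopology (sft_space D) (cylinder v)) fst"
    using fst_bisection[OF assms]
    by (intro continuous_map_into_subtopology continuous_map_from_subtopology
        continuous_map_fst_sft_groupoid) auto
  show "open_map (subtopology (sft_groupoid_top D) (bisection v w))
      (subtopology (sft_space D) (cylinder v)) fst"
    unfolding open_map_def openin_open_subtopology[OF op] openin_open_subtopology[OF openin_cylinder]
    using open_map_fst_sft_groupoid fst_bisection[OF assms] unfolding open_map_def by blast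
  show "fst ` topspace (subtopology (sft_groupoid_top D) (bisection v w)) =
      topspace (subtopology (sft_space D) (cylinder v))"
    using sub fst_bisection[OF assms] cylinder_subset
    by (simp add: topspace_sft_space inf.absorb2)
  show "inj_on fst (topspace (subtopology (sft_groupoid_top D) (bisection v w)))"
    using inj_on_bisection(1) by (rule inj_on_subset) auto
qed

text \<open>Compactness is carried back from the cylinder set \<open>cylinder v\<close> along the
  homeomorphism \<open>fst\<close>.\<close>

lemma compactin_bisection:
  assumes "interchangeable v w"
  shows "compactin (sft_groupoid_top D) (bisection v w)"
proof -
  have "compactin (subtopology (sft_space D) (cylinder v)) (cylinder v)"
    by (simp add: compactin_subtopology compactin_cylinder)
  moreover have "openin (sft_groupoid_top D) (bisection v w)"
    using assms openin_bisection by (simp add: interchangeable_def)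
  then have "bisection v w \<subseteq> topspace (sft_groupoid_top D)"
    by (rule openin_subset)
  ultimately have "compactin (subtopology (sft_groupoid_top D) (bisection v w)) (bisection v w)"
    by (subst homeomorphic_map_compactness_eq[OF homeomorphic_map_fst_bisection[OF assms]])
      (simp add: fst_bisection[OF assms])
  then show ?thesis
    by (simp add: compactin_subtopology)
qed

section \<open>Separation, countability and local compactness\<close>

text \<open>A continuous injection into a Hausdorff space suffices; it need not be an embedding. The
  target is the product of two copies of the shift with the discrete integers.\<close>

lemma Hausdorff_space_sft_groupoid: "Hausdorff_space (sft_groupoid_top D)"
proof (rule Hausdorff_space_injective_preimage)
  show "Hausdorff_space (prod_topology (sft_space D)
      (prod_topology (discrete_topology (UNIV :: int set)) (sft_space D)))"
    by (simp add: Hausdorff_space_prod_topology Hausdorff_space_sft)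
  \<comment> \<open>The lag is constant on each bisection, hence locally constant.\<close>
  have "continuous_map (sft_groupoid_top D) (discrete_topology UNIV) (fst \<circ> snd)"
    unfolding continuous_map_def
  proof (intro conjI allI impI)
    fix N :: "int set"
    have "\<exists>W. openin (sft_groupoid_top D) W \<and> g \<in> W \<and>
        W \<subseteq> {g \<in> topspace (sft_groupoid_top D). (fst \<circ> snd) g \<in> N}"
      if g: "g \<in> topspace (sft_groupoid_top D)" "(fst \<circ> snd) g \<in> N" for g
    proof -
      obtain x n y where xny: "g = (x, n, y)"
        by (cases g)
      obtain k l where kl: "interchangeable (prefix k x) (prefix l y)"
          "bisection (prefix k x) (prefix l y) \<subseteq> topspace (sft_groupoid_top D)"
          "(x, n, y) \<in> bisection (prefix k x) (prefix l y)"
        by (rule openin_sft_groupoidE[OF openin_topspace g(1)[unfolded xny]])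
      then have "openin (sft_groupoid_top D) (bisection (prefix k x) (prefix l y))"
        by (simp add: interchangeable_def openin_bisection)
      moreover have "(fst \<circ> snd) h = n" if "h \<in> bisection (prefix k x) (prefix l y)" for h
        using that kl(3) by (auto simp: bisection_def)
      ultimately show ?thesis
        using kl(2,3) g(2) xny by (intro exI[of _ "bisection (prefix k x) (prefix l y)"]) auto
    qed
    then show "openin (sft_groupoid_top D) {g \<in> topspace (sft_groupoid_top D). (fst \<circ> snd) g \<in> N}"
      by (subst openin_subopen) blast
  qed auto
  then show "continuous_map (sft_groupoid_top D) (prod_topology (sft_space D)
      (prod_topology (discrete_topology UNIV) (sft_space D)))
      (\<lambda>g. (fst g, (fst \<circ> snd) g, (snd \<circ> snd) g))"
    using continuous_map_fst_sft_groupoid continuous_map_snd_sft_groupoid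
    by (intro continuous_map_pairedI) (auto simp: comp_def)
  show "inj_on (\<lambda>g. (fst g, (fst \<circ> snd) g, (snd \<circ> snd) g)) (topspace (sft_groupoid_top D))"
    by (auto simp: inj_on_def)
qed

lemma second_countable_sft_groupoid: "second_countable (sft_groupoid_top D)"
  unfolding second_countable_def
proof (intro exI conjI allI impI ballI)
  \<comment> \<open>Prefixes of points of the shift use arcs only, so words over the finite set
    \<open>arcs D\<close> suffice; the type of letters itself may be uncountable.\<close>
  let ?W = "lists (arcs D) - {[]}"
  show "countable ((\<lambda>(v, w). bisection v w) ` (?W \<times> ?W))"
    by (intro countable_image countable_SIGMA countable_Diff countable_lists countable_finite) simp_all
  show "openin (sft_groupoid_top D) V" if "V \<in> (\<lambda>(v, w). bisection v w) ` (?W \<times> ?W)" for V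
    using that openin_bisection by auto
  fix U g
  assume U: "openin (sft_groupoid_top D) U \<and> g \<in> U"
  obtain x n y where g: "g = (x, n, y)"
    by (cases g)
  then obtain k l where kl: "interchangeable (prefix k x) (prefix l y)"
      "bisection (prefix k x) (prefix l y) \<subseteq> U" "(x, n, y) \<in> bisection (prefix k x) (prefix l y)"
    using U by (metis openin_sft_groupoidE)
  have "g \<in> arrows (sft_groupoid D)"
    using U openin_subset by (auto simp: topspace_sft_groupoid_top[symmetric])
  then have "x \<in> sft D" "y \<in> sft D"
    using arrow_sft_groupoidD g by auto
  then have "(prefix k x, prefix l y) \<in> ?W \<times> ?W"
    using kl(1) by (auto simp: interchangeable_def sft_def)
  then have "bisection (prefix k x) (prefix l y) \<in> (\<lambda>(v, w). bisection v w) ` (?W \<times> ?W)"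
    by (rule rev_image_eqI) simp
  then show "\<exists>V \<in> (\<lambda>(v, w). bisection v w) ` (?W \<times> ?W). g \<in> V \<and> V \<subseteq> U"
    using kl(2,3) g by (intro bexI) auto
qed

lemma locally_compact_space_sft_groupoid: "locally_compact_space (sft_groupoid_top D)"
  unfolding locally_compact_space_def
proof
  fix g
  assume g: "g \<in> topspace (sft_groupoid_top D)"
  obtain x n y where xny: "g = (x, n, y)"
    by (cases g)
  obtain k l where kl: "interchangeable (prefix k x) (prefix l y)"
      "(x, n, y) \<in> bisection (prefix k x) (prefix l y)"
    by (rule openin_sft_groupoidE[OF openin_topspace g[unfolded xny]])
  then have "openin (sft_groupoid_top D) (bisection (prefix k x) (prefix l y))"
    by (simp add: interchangeable_def openin_bisection)
  then show "\<exists>U K. openin (sft_groupoid_top D) U \<and> compactin (sft_groupoid_top D) K \<and> g \<in> U \<and> U \<subseteq> K"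
    using compactin_bisection[OF kl(1)] kl(2) xny by blast
qed

lemma rng_sft_groupoid: "grng (sft_groupoid D) = unit_embedding \<circ> fst"
  and src_sft_groupoid: "gsrc (sft_groupoid D) = unit_embedding \<circ> (snd \<circ> snd)"
  by (simp_all add: fun_eq_iff split_paired_all)

text \<open>On a bisection the range map is \<open>fst\<close>, a homeomorphism onto a cylinder set,
  followed by the identification of the shift with the unit space.\<close>

lemma local_homeomorphism_rng_sft_groupoid:
  "local_homeomorphism (sft_groupoid_top D) (unit_space (sft_groupoid D)) (grng (sft_groupoid D))"
  unfolding local_homeomorphism_def
proof
  fix g
  assume g: "g \<in> topspace (sft_groupoid_top D)"
  obtain x n y where xny: "g = (x, n, y)"
    by (cases g)
  obtain k l where kl: "interchangeable (prefix k x) (prefix l y)"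
      "(x, n, y) \<in> bisection (prefix k x) (prefix l y)"
    by (rule openin_sft_groupoidE[OF openin_topspace g[unfolded xny]])
  define v w where "v = prefix k x" and "w = prefix l y"
  have vw: "interchangeable v w" and g_in: "g \<in> bisection v w"
    using kl by (simp_all add: v_def w_def xny)
  have rng: "grng (sft_groupoid D) ` bisection v w = unit_embedding ` cylinder v"
    unfolding rng_sft_groupoid image_comp[symmetric] fst_bisection[OF vw] ..
  have sub: "unit_embedding ` cylinder v \<subseteq> topspace (unit_space (sft_groupoid D))"
    using homeomorphic_imp_surjective_map[OF homeomorphic_map_unit_embedding] cylinder_subset
    by (auto simp: topspace_sft_space)
  have "openin (unit_space (sft_groupoid D)) (unit_embedding ` cylinder v)"
    using homeomorphic_imp_open_map[OF homeomorphic_map_unit_embedding] openin_cylinder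
    by (simp add: open_map_def)
  moreover have "openin (sft_groupoid_top D) (bisection v w)"
    using vw by (simp add: interchangeable_def openin_bisection)
  moreover have "homeomorphic_map (subtopology (sft_space D) (cylinder v))
      (subtopology (unit_space (sft_groupoid D)) (unit_embedding ` cylinder v)) unit_embedding"
    using cylinder_subset sub
    by (intro homeomorphic_map_subtopologies homeomorphic_map_unit_embedding)
      (simp add: topspace_sft_space inf.absorb2)
  then have "homeomorphic_map (subtopology (sft_groupoid_top D) (bisection v w))
      (subtopology (unit_space (sft_groupoid D)) (unit_embedding ` cylinder v)) (grng (sft_groupoid D))"
    unfolding rng_sft_groupoid
    by (rule homeomorphic_map_compose[OF homeomorphic_map_fst_bisection[OF vw]])
  ultimately show "\<exists>U. openin (sft_groupoid_top D) U \<and> g \<in> U \<and>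
      openin (unit_space (sft_groupoid D)) (grng (sft_groupoid D) ` U) \<and>
      homeomorphic_map (subtopology (sft_groupoid_top D) U)
        (subtopology (unit_space (sft_groupoid D)) (grng (sft_groupoid D) ` U)) (grng (sft_groupoid D))"
    using g_in rng by (intro exI[of _ "bisection v w"]) simp
qed

section \<open>Continuity of inversion and multiplication\<close>

text \<open>Inversion swaps the two words of a bisection.\<close>

lemma continuous_map_inv_sft_groupoid:
  "continuous_map (sft_groupoid_top D) (sft_groupoid_top D) (ginv (sft_groupoid D))"
proof -
  interpret G: groupoid "sft_groupoid D"
    by (rule groupoid_sft_groupoid)
  have "openin (sft_groupoid_top D) {g \<in> topspace (sft_groupoid_top D). ginv (sft_groupoid D) g \<in> U}"
    if U: "openin (sft_groupoid_top D) U" for U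
  proof (rule openin_subopen[THEN iffD2], intro ballI)
    fix g
    assume "g \<in> {g \<in> topspace (sft_groupoid_top D). ginv (sft_groupoid D) g \<in> U}"
    moreover obtain x n y where g: "g = (x, n, y)"
      by (cases g)
    ultimately have inv: "(y, - n, x) \<in> U"
      by simp
    obtain k l where kl: "interchangeable (prefix k y) (prefix l x)"
        "bisection (prefix k y) (prefix l x) \<subseteq> U" "(y, - n, x) \<in> bisection (prefix k y) (prefix l x)"
      by (rule openin_sft_groupoidE[OF U inv])
    have op: "openin (sft_groupoid_top D) (bisection (prefix l x) (prefix k y))"
      using kl(1) by (simp add: interchangeable_def openin_bisection)
    have inv_mem: "ginv (sft_groupoid D) h \<in> bisection v w \<longleftrightarrow> h \<in> bisection w v" for h v w
      by (cases h) (auto simp: bisection_def)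
    have "g \<in> bisection (prefix l x) (prefix k y)"
      using kl(3) inv_mem[of g] by (simp add: g)
    then show "\<exists>T. openin (sft_groupoid_top D) T \<and> g \<in> T \<and>
        T \<subseteq> {g \<in> topspace (sft_groupoid_top D). ginv (sft_groupoid D) g \<in> U}"
    proof (intro exI[of _ "bisection (prefix l x) (prefix k y)"] conjI subsetI)
      fix h
      assume h: "h \<in> bisection (prefix l x) (prefix k y)"
      then have "ginv (sft_groupoid D) h \<in> bisection (prefix k y) (prefix l x)"
        by (simp only: inv_mem)
      then show "h \<in> {g \<in> topspace (sft_groupoid_top D). ginv (sft_groupoid D) g \<in> U}"
        using h openin_subset[OF op] kl(2) by blast
    qed (simp_all add: op)
  qed
  moreover have "ginv (sft_groupoid D) \<in> topspace (sft_groupoid_top D) \<rightarrow> topspace (sft_groupoid_top D)"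
    using G.inv_closed unfolding topspace_sft_groupoid_top by blast
  ultimately show ?thesis
    unfolding continuous_map_def by blast
qed

text \<open>Bisections with a common middle word multiply into the bisection of the two outer words,
  so it remains to describe both factors with the same middle word.\<close>

lemma continuous_map_mul_sft_groupoid:
  "continuous_map
    (subtopology (prod_topology (sft_groupoid_top D) (sft_groupoid_top D)) (composable (sft_groupoid D)))
    (sft_groupoid_top D) (\<lambda>(g, h). gmul (sft_groupoid D) g h)"
  (is "continuous_map ?C _ ?m")
proof -
  interpret G: groupoid "sft_groupoid D"
    by (rule groupoid_sft_groupoid)
  have top: "topspace ?C = composable (sft_groupoid D)"
    by (auto simp: topspace_sft_groupoid_top composable_def)
  have "openin ?C {p \<in> topspace ?C. ?m p \<in> U}" if U: "openin (sft_groupoid_top D) U" for U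
  proof (rule openin_subopen[THEN iffD2], intro ballI)
    fix p
    assume p: "p \<in> {p \<in> topspace ?C. ?m p \<in> U}"
    obtain x n y y' m z where "p = ((x, n, y), (y', m, z))"
      by (metis surj_pair)
    moreover from this have "y = y'"
      using p by (auto simp: composable_def)
    ultimately have p_eq: "p = ((x, n, y), (y, m, z))"
      by simp
    have arr: "(x, n, y) \<in> arrows (sft_groupoid D)" "(y, m, z) \<in> arrows (sft_groupoid D)"
      and mul: "(x, n + m, z) \<in> U"
      using p by (auto simp: p_eq composable_def topspace_sft_groupoid_top)
    obtain N where N: "\<And>k. k \<ge> N \<Longrightarrow> \<exists>l. l \<ge> 1 \<and> m = int k - int l \<and> suffix k y = suffix l z"
      using eventually_arrow_exponents[OF arr(2), of 0] unfolding eventually_sequentially by meson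
    \<comment> \<open>The exponent \<open>l\<close> serves both factors: beyond \<open>N\<close> it
      is also a first exponent of the second arrow. At the same time \<open>k\<close> is so large
      that the bisection around the product lies in \<open>U\<close>.\<close>
    obtain k l where kl: "k \<ge> 1" "l \<ge> 1" "n = int k - int l" "suffix k x = suffix l y" "l \<ge> N"
      and sub: "\<And>j. n + m = int k - int j \<Longrightarrow> bisection (prefix k x) (prefix j z) \<subseteq> U"
      using eventually_happens'[OF sequentially_bot eventually_conj[OF
          eventually_bisection_subset[OF U mul] eventually_arrow_exponents[OF arr(1), of N]]]
      by blast
    obtain j where j: "j \<ge> 1" "m = int l - int j" "suffix l y = suffix j z"
      using N[OF kl(5)] by blast
    let ?V = "bisection (prefix k x) (prefix l y)" and ?W = "bisection (prefix l y) (prefix j z)"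
    have "openin (prod_topology (sft_groupoid_top D) (sft_groupoid_top D)) (?V \<times> ?W)"
      using kl(1,2) j(1) by (simp add: openin_prod_Times_iff openin_bisection)
    then have "openin ?C (composable (sft_groupoid D) \<inter> ?V \<times> ?W)"
      by (rule openin_subtopology_Int2)
    moreover have "p \<in> composable (sft_groupoid D) \<inter> ?V \<times> ?W"
      using p top arr[THEN arrow_sft_groupoidD(1)] arr[THEN arrow_sft_groupoidD(2)] kl j
      by (auto simp: p_eq intro!: mem_bisection_prefix)
    moreover have "composable (sft_groupoid D) \<inter> ?V \<times> ?W \<subseteq> {p \<in> topspace ?C. ?m p \<in> U}"
    proof
      fix q
      assume q: "q \<in> composable (sft_groupoid D) \<inter> ?V \<times> ?W"
      then obtain s t where
        st: "q = ((prefix k x \<frown> s, n, prefix l y \<frown> s), (prefix l y \<frown> t, m, prefix j z \<frown> t))"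
          "prefix k x \<frown> s \<in> sft D" "prefix j z \<frown> t \<in> sft D"
        using kl(3) j(2) by (auto simp: bisection_def)
      \<comment> \<open>Composability equates the two continuations of the middle word.\<close>
      then have "s = t"
        using q by (auto simp: composable_def)
      have "?m q \<in> bisection (prefix k x) (prefix j z)"
        using st kl(3) j(2) by (auto simp: bisection_def \<open>s = t\<close>)
      then show "q \<in> {p \<in> topspace ?C. ?m p \<in> U}"
        using sub[of j] q kl(3) j(2) unfolding top by auto
    qed
    ultimately show "\<exists>T. openin ?C T \<and> p \<in> T \<and> T \<subseteq> {p \<in> topspace ?C. ?m p \<in> U}"
      by blast
  qed
  moreover have "?m \<in> topspace ?C \<rightarrow> topspace (sft_groupoid_top D)"
    using G.mul_closed unfolding top topspace_sft_groupoid_top by auto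
  ultimately show ?thesis
    unfolding continuous_map_def by blast
qed

lemma etale_groupoid_sft_groupoid: "etale_groupoid (sft_groupoid D)"
  unfolding etale_groupoid_def etale_groupoid_axioms_def
    topological_groupoid_def topological_groupoid_axioms_def
  by (simp add: groupoid_sft_groupoid continuous_map_mul_sft_groupoid continuous_map_inv_sft_groupoid
      second_countable_sft_groupoid locally_compact_space_sft_groupoid Hausdorff_space_sft_groupoid
      local_homeomorphism_rng_sft_groupoid)

end

section \<open>Minimality and pure infiniteness\<close>

lemma compact_open_G_set_reduction:
  assumes "compact_open_G_set G U" and "grng G ` U \<subseteq> Y" and "gsrc G ` U \<subseteq> Y"
  shows "compact_open_G_set (reduction G Y) U"
proof -
  have "U \<subseteq> {g \<in> arrows G. grng G g \<in> Y \<and> gsrc G g \<in> Y}"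
    using assms by (auto simp: compact_open_G_set_def is_G_set_def)
  moreover from this have "openin (subtopology (gtop G) {g \<in> arrows G. grng G g \<in> Y \<and> gsrc G g \<in> Y}) U"
    using assms(1) unfolding compact_open_G_set_def by (metis inf.absorb2 openin_subtopology_Int2)
  ultimately show ?thesis
    using assms(1)
    by (auto simp: compact_open_G_set_def is_G_set_def arrows_reduction compactin_subtopology)
qed

context finite_graph_shift
begin

lemma snd_bisection:
  assumes "interchangeable v w"
  shows "(snd \<circ> snd) ` bisection v w = cylinder w"
proof -
  have "{w \<frown> z | z. w \<frown> z \<in> sft D} \<subseteq> (snd \<circ> snd) ` bisection v w"
    using assms by (auto simp: bisection_def interchangeable_def image_iff)
  then show ?thesis
    by (auto simp: cylinder_eq bisection_def)
qed

lemma cylinder_append_subset: "cylinder (u @ v) \<subseteq> cylinder u"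
proof
  fix x
  assume "x \<in> cylinder (u @ v)"
  then have "x \<in> sft D" "prefix (length u + length v) x = u @ v"
    by (auto simp: cylinder_def)
  moreover from this(2) have "prefix (length u) x = u"
    unfolding subsequence_append by (simp add: append_eq_append_conv)
  ultimately show "x \<in> cylinder u"
    by (simp add: cylinder_def)
qed

lemma nth_cylinder: "x \<in> cylinder w \<Longrightarrow> i < length w \<Longrightarrow> x i = w ! i"
  by (metis (mono_tags, lifting) add_0 cylinder_def diff_zero mem_Collect_eq subsequence_nth)

lemma disjoint_cylinders_eq_length:
  assumes "length v = length w" and "v \<noteq> w"
  shows "cylinder v \<inter> cylinder w = {}"
  using assms by (auto simp: cylinder_def)

lemma openin_unit_embedding_image_iff:
  assumes "A \<subseteq> sft D"
  shows "openin (unit_space (sft_groupoid D)) (unit_embedding ` A) \<longleftrightarrow> openin (sft_space D) A"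
  using homeomorphic_map_openness[OF homeomorphic_map_unit_embedding] assms
  by (simp add: topspace_sft_space)

lemma closedin_unit_embedding_image_iff:
  assumes "A \<subseteq> sft D"
  shows "closedin (unit_space (sft_groupoid D)) (unit_embedding ` A) \<longleftrightarrow> closedin (sft_space D) A"
  using homeomorphic_map_closedness[OF homeomorphic_map_unit_embedding] assms
  by (simp add: topspace_sft_space)

text \<open>Bisections are glued to realise the piecewise exchange of each \<open>w\<close> for
  \<open>m w\<close>. Disjoint source cylinders and disjoint range cylinders make the union a
  \<open>G\<close>-set; finiteness keeps it compact.\<close>

lemma compact_open_G_set_Union_bisection:
  assumes W: "finite W" and m: "\<And>w. w \<in> W \<Longrightarrow> interchangeable (m w) w"
    and src: "\<And>v w. v \<in> W \<Longrightarrow> w \<in> W \<Longrightarrow> v \<noteq> w \<Longrightarrow> cylinder v \<inter> cylinder w = {}"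
    and rng: "\<And>v w. v \<in> W \<Longrightarrow> w \<in> W \<Longrightarrow> v \<noteq> w \<Longrightarrow> cylinder (m v) \<inter> cylinder (m w) = {}"
  defines "U \<equiv> \<Union>w\<in>W. bisection (m w) w"
  shows "compact_open_G_set (sft_groupoid D) U"
    and "grng (sft_groupoid D) ` U = unit_embedding ` (\<Union>w\<in>W. cylinder (m w))"
    and "gsrc (sft_groupoid D) ` U = unit_embedding ` (\<Union>w\<in>W. cylinder w)"
proof -
  have op: "openin (sft_groupoid_top D) U"
    unfolding U_def using m openin_bisection by (intro openin_Union) (auto simp: interchangeable_def)
  then have sub: "U \<subseteq> arrows (sft_groupoid D)"
    by (simp add: openin_subset topspace_sft_groupoid_top[symmetric])
  have comp: "compactin (sft_groupoid_top D) U"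
    unfolding U_def using W m compactin_bisection by (intro compactin_Union) auto
  have inj: "g = h"
    if gh: "g \<in> U" "h \<in> U" and eq: "fst g = fst h \<or> snd (snd g) = snd (snd h)" for g h
  proof -
    obtain v w where v: "v \<in> W" "g \<in> bisection (m v) v" and w: "w \<in> W" "h \<in> bisection (m w) w"
      using gh unfolding U_def by blast
    have "fst g \<in> cylinder (m v)" "snd (snd g) \<in> cylinder v"
      "fst h \<in> cylinder (m w)" "snd (snd h) \<in> cylinder w"
      using v(2) w(2) by (auto simp: bisection_def cylinder_def)
    then have "v = w"
      using eq src[OF v(1) w(1)] rng[OF v(1) w(1)] by (metis IntI empty_iff)
    then show ?thesis
      using eq v(2) w(2) inj_on_bisection[of "m w" w] by (auto simp: inj_on_def)
  qed
  show "compact_open_G_set (sft_groupoid D) U"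
    unfolding compact_open_G_set_def is_G_set_def rng_sft_groupoid src_sft_groupoid
    using op sub comp inj by (auto simp: inj_on_def)
  show "grng (sft_groupoid D) ` U = unit_embedding ` (\<Union>w\<in>W. cylinder (m w))"
    unfolding rng_sft_groupoid U_def image_comp[symmetric] image_UN
    using fst_bisection[OF m] by simp
  show "gsrc (sft_groupoid D) ` U = unit_embedding ` (\<Union>w\<in>W. cylinder w)"
    unfolding src_sft_groupoid U_def image_comp[symmetric, of unit_embedding] image_UN
    using snd_bisection[OF m] by simp
qed

text \<open>By compactness finitely many cylinder sets inside \<open>A\<close> cover
  \<open>A\<close>, so one prefix length works for all points.\<close>

lemma clopenin_union_of_cylinders:
  assumes "clopenin (sft_space D) A"
  obtains N where "N \<ge> 1" and "\<And>x. x \<in> A \<Longrightarrow> cylinder (prefix N x) \<subseteq> A"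
proof -
  let ?W = "{w. cylinder w \<subseteq> A}"
  have "compactin (sft_space D) A"
    using assms by (simp add: clopenin_def closedin_compact_space compact_space_sft)
  moreover have "A \<subseteq> \<Union> (cylinder ` ?W)"
  proof
    fix x
    assume x: "x \<in> A"
    then obtain n where n: "cylinder (prefix n x) \<subseteq> A"
      using assms eventually_happens'[OF sequentially_bot eventually_cylinder_subset]
      unfolding clopenin_def by meson
    have "x \<in> sft D"
      using x assms openin_subset unfolding clopenin_def topspace_sft_space[symmetric] by blast
    then have "x \<in> cylinder (prefix n x)"
      by (simp add: cylinder_def)
    then show "x \<in> \<Union> (cylinder ` ?W)"
      using n by blast
  qed
  ultimately obtain \<F> where \<F>: "finite \<F>" "\<F> \<subseteq> cylinder ` ?W" "A \<subseteq> \<Union>\<F>"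
    using openin_cylinder unfolding compactin_def by (metis (no_types, lifting) imageE)
  then obtain W where W: "finite W" "W \<subseteq> ?W" "\<F> = cylinder ` W"
    using finite_subset_image by metis
  \<comment> \<open>The sum bounds every length; \<open>Suc\<close> makes the prefixes nonempty, as
    exchanged words must be.\<close>
  define N where "N = Suc (\<Sum>w\<in>W. length w)"
  have "cylinder (prefix N x) \<subseteq> A" if "x \<in> A" for x
  proof -
    obtain w where w: "w \<in> W" "x \<in> cylinder w"
      using \<open>x \<in> A\<close> \<F>(3) W(3) by blast
    then have "length w \<le> N"
      unfolding N_def using member_le_sum[of w W length] W(1) by simp
    then have "cylinder (prefix N x) \<subseteq> cylinder (prefix (length w) x)"
      by (rule cylinder_prefix_mono)
    also have "prefix (length w) x = w"
      using w(2) by (simp add: cylinder_def)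
    finally show ?thesis
      using w(1) W(2) by blast
  qed
  then show ?thesis
    by (intro that[of N]) (simp_all add: N_def)
qed

section \<open>From the matrix to walks and branching\<close>

lemma matrix_pow_pos_imp_awalk:
  assumes "matrix_pow (verts D) (adj_matrix D) n \<xi> \<eta> > 0" and "\<xi> \<in> verts D"
  shows "\<exists>p. awalk \<xi> p \<eta> \<and> length p = n"
  using assms(1)
proof (induction n arbitrary: \<eta>)
  case 0
  then show ?case
    using assms(2) by (auto simp: awalk_Nil_iff split: if_splits)
next
  case (Suc n)
  then obtain \<zeta> where pow: "matrix_pow (verts D) (adj_matrix D) n \<xi> \<zeta> > 0"
      and adj: "adj_matrix D \<zeta> \<eta> > 0"
    by (auto simp: sum_eq_0_iff simp flip: neq0_conv)
  obtain p where p: "awalk \<xi> p \<zeta>" "length p = n"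
    using Suc.IH[OF pow] by blast
  have "{e \<in> arcs D. tail D e = \<zeta> \<and> head D e = \<eta>} \<noteq> {}"
    using adj unfolding adj_matrix_def by (metis card.empty less_numeral_extra(3))
  then obtain e where "e \<in> arcs D" "tail D e = \<zeta>" "head D e = \<eta>"
    by blast
  then have "awalk \<zeta> [e] \<eta>"
    using arc_implies_awalk by blast
  then have "awalk \<xi> (p @ [e]) \<eta>"
    using p(1) by (rule awalk_appendI[rotated])
  then show ?case
    using p(2) by (intro exI[of _ "p @ [e]"]) simp
qed

text \<open>The exponent is at least 1, so the walk is nonempty even for \<xi> = \<eta>; this puts
  every vertex on a closed walk.\<close>

lemma irreducible_imp_awalk:
  assumes "irreducible_matrix (verts D) (adj_matrix D)" and "\<xi> \<in> verts D" and "\<eta> \<in> verts D"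
  shows "\<exists>p. awalk \<xi> p \<eta> \<and> p \<noteq> []"
proof -
  obtain n where "n \<ge> 1" "matrix_pow (verts D) (adj_matrix D) n \<xi> \<eta> > 0"
    using assms unfolding irreducible_matrix_def by blast
  then show ?thesis
    using matrix_pow_pos_imp_awalk[of n \<xi> \<eta>] assms(2) by fastforce
qed

text \<open>
  If no vertex emits two arcs, then following arcs is a self-map of the vertices, and irreducibility
  makes it surjective.
\<close>

lemma irreducible_imp_branching:
  assumes irred: "irreducible_matrix (verts D) (adj_matrix D)"
    and not_perm: "\<not> permutation_matrix (verts D) (adj_matrix D)"
  shows "\<exists>e \<in> arcs D. \<exists>f \<in> arcs D. e \<noteq> f \<and> tail D e = tail D f"
proof (rule ccontr)
  assume "\<not> ?thesis"
  then have unique: "e = f" if "e \<in> arcs D" "f \<in> arcs D" "tail D e = tail D f" for e f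
    using that by blast
  have out: "\<exists>e \<in> arcs D. tail D e = \<xi>" and into: "\<exists>e \<in> arcs D. head D e = \<xi>"
    if \<xi>: "\<xi> \<in> verts D" for \<xi>
  proof -
    \<comment> \<open>The first arc of a nonempty closed walk leaves \<xi>, and its last arc enters
      \<xi>.\<close>
    obtain p where p: "awalk \<xi> p \<xi>" "p \<noteq> []"
      using irreducible_imp_awalk[OF irred \<xi> \<xi>] by blast
    show "\<exists>e \<in> arcs D. tail D e = \<xi>"
      using p by (cases p) (auto simp: awalk_Cons_iff)
    show "\<exists>e \<in> arcs D. head D e = \<xi>"
      using p by (cases p rule: rev_cases) (auto simp: awalk_append_iff awalk_simps)
  qed
  obtain a where a: "\<And>\<xi>. \<xi> \<in> verts D \<Longrightarrow> a \<xi> \<in> arcs D \<and> tail D (a \<xi>) = \<xi>"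
    using out by metis
  \<comment> \<open>The value outside \<open>verts D\<close> is dictated by \<open>permutes\<close>,
    which asks for fixed points there.\<close>
  define \<pi> where "\<pi> \<xi> = (if \<xi> \<in> verts D then head D (a \<xi>) else \<xi>)" for \<xi>
  have a_tail: "a (tail D e) = e" if "e \<in> arcs D" for e
    using a[of "tail D e"] unique that by auto
  have "\<pi> ` verts D = verts D"
  proof
    show "\<pi> ` verts D \<subseteq> verts D"
      using a by (auto simp: \<pi>_def)
    show "verts D \<subseteq> \<pi> ` verts D"
    proof
      fix \<eta>
      assume "\<eta> \<in> verts D"
      then obtain e where "e \<in> arcs D" "head D e = \<eta>"
        using into by blast
      then show "\<eta> \<in> \<pi> ` verts D"
        using a_tail by (intro image_eqI[of _ _ "tail D e"]) (auto simp: \<pi>_def)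
    qed
  qed
  then have "bij_betw \<pi> (verts D) (verts D)"
    by (simp add: bij_betw_def eq_card_imp_inj_on)
  then have "\<pi> permutes verts D"
    by (rule bij_imp_permutes) (simp add: \<pi>_def)
  moreover have "adj_matrix D \<xi> \<eta> = (if \<eta> = \<pi> \<xi> then 1 else 0)" if "\<xi> \<in> verts D" for \<xi> \<eta>
  proof -
    have "{e \<in> arcs D. tail D e = \<xi> \<and> head D e = \<eta>} = (if \<eta> = \<pi> \<xi> then {a \<xi>} else {})"
    proof -
      have "e \<in> arcs D \<and> tail D e = \<xi> \<longleftrightarrow> e = a \<xi>" for e
        using a[OF that] a_tail[of e] by metis
      then have "{e \<in> arcs D. tail D e = \<xi> \<and> head D e = \<eta>} = {e. e = a \<xi> \<and> head D e = \<eta>}"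
        by (simp only: conj_assoc[symmetric])
      also have "\<dots> = (if \<eta> = head D (a \<xi>) then {a \<xi>} else {})"
        by auto
      finally show ?thesis
        using that by (simp only: \<pi>_def if_True)
    qed
    then show ?thesis
      by (simp add: adj_matrix_def)
  qed
  ultimately show False
    using not_perm unfolding permutation_matrix_def by blast
qed

text \<open>
  Two loops \<open>\<alpha>\<close>, \<open>\<beta>\<close> at a common vertex with different first arcs give the pairwise incomparable loops
  \<open>\<alpha>\<^sup>j \<beta>\<close>, which are reached from \<open>u\<close> and then continued to the prescribed end vertex \<open>\<eta>\<close>.
\<close>

lemma disjoint_extensions:
  assumes irred: "irreducible_matrix (verts D) (adj_matrix D)"
    and not_perm: "\<not> permutation_matrix (verts D) (adj_matrix D)"
    and u: "awalk \<zeta> u \<zeta>'"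
  obtains v :: "'v \<Rightarrow> nat \<Rightarrow> 'e list"
    where "\<And>\<eta> j. \<eta> \<in> verts D \<Longrightarrow> awalk \<zeta> (v \<eta> j) \<eta>"
    and "\<And>\<eta> j. v \<eta> j \<noteq> []" and "\<And>\<eta> j. cylinder (v \<eta> j) \<subseteq> cylinder u"
    and "\<And>\<eta> \<eta>' i j. i \<noteq> j \<Longrightarrow> cylinder (v \<eta> i) \<inter> cylinder (v \<eta>' j) = {}"
proof -
  obtain e f where ef: "e \<in> arcs D" "f \<in> arcs D" "e \<noteq> f" "tail D e = tail D f"
    using irreducible_imp_branching[OF irred not_perm] by blast
  define \<xi> where "\<xi> = tail D e"
  have \<xi>: "\<xi> \<in> verts D"
    using ef by (simp add: \<xi>_def)
  have walk: "\<exists>p. awalk \<eta> p \<eta>'" if "\<eta> \<in> verts D" "\<eta>' \<in> verts D" for \<eta> \<eta>'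
    using irreducible_imp_awalk[OF irred that] by blast
  obtain p where p: "awalk \<zeta>' p \<xi>"
    using walk[OF awalk_last_in_verts[OF u] \<xi>] by blast
  \<comment> \<open>In the proof \<alpha> and \<beta> are only the ways back to \<xi>: the two loops
    are \<open>e # \<alpha>\<close> and \<open>f # \<beta>\<close>.\<close>
  obtain \<alpha> where \<alpha>: "awalk (head D e) \<alpha> \<xi>"
    using walk[OF head_in_verts[OF ef(1)] \<xi>] by blast
  obtain \<beta> where \<beta>: "awalk (head D f) \<beta> \<xi>"
    using walk[OF head_in_verts[OF ef(2)] \<xi>] by blast
  obtain q where q: "\<And>\<eta>. \<eta> \<in> verts D \<Longrightarrow> awalk \<xi> (q \<eta>) \<eta>"
    using walk[OF \<xi>] by metis
  define s where "s j = u @ p @ concat (replicate j (e # \<alpha>))" for j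
  define v where "v \<eta> j = s j @ f # \<beta> @ q \<eta>" for \<eta> j
  have "awalk \<xi> (e # \<alpha>) \<xi>"
    using \<alpha> ef by (simp add: awalk_Cons_iff \<xi>_def)
  then have "awalk \<xi> (concat (replicate j (e # \<alpha>))) \<xi>" for j
    by (induction j) (simp add: awalk_Nil_iff \<xi>, simp only: replicate_Suc concat.simps awalk_appendI)
  then have "awalk \<zeta> (s j) \<xi>" for j
    unfolding s_def by (intro awalk_appendI[OF u] awalk_appendI[OF p])
  moreover have "awalk \<xi> (f # \<beta> @ q \<eta>) \<eta>" if "\<eta> \<in> verts D" for \<eta>
    using awalk_appendI[OF \<beta> q[OF that]] ef by (simp add: awalk_Cons_iff \<xi>_def)
  ultimately have "awalk \<zeta> (v \<eta> j) \<eta>" if "\<eta> \<in> verts D" for \<eta> j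
    unfolding v_def using that by (intro awalk_appendI)
  moreover have "v \<eta> j \<noteq> []" for \<eta> j
    by (simp add: v_def)
  moreover have "cylinder (v \<eta> j) \<subseteq> cylinder u" for \<eta> j
    unfolding v_def s_def append_assoc by (rule cylinder_append_subset)
  moreover have less: "cylinder (v \<eta> i) \<inter> cylinder (v \<eta>' j) = {}" if "i < j" for \<eta> \<eta>' i j
  proof -
    \<comment> \<open>For \<open>i < j\<close> both words begin with \<open>s i\<close>. The next
      letter is \<open>f\<close> in the first and \<open>e\<close> in the second, whatever end
      vertices are prescribed.\<close>
    have "replicate j (e # \<alpha>) = replicate i (e # \<alpha>) @ (e # \<alpha>) # replicate (j - i - 1) (e # \<alpha>)"
      using that by (simp flip: replicate_Suc replicate_add add: Suc_diff_Suc)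
    then obtain t where t: "v \<eta>' j = s i @ e # t"
      by (simp add: v_def s_def)
    have "x (length (s i)) = f" if "x \<in> cylinder (v \<eta> i)" for x
      using nth_cylinder[OF that, of "length (s i)"] by (simp add: v_def)
    moreover have "x (length (s i)) = e" if "x \<in> cylinder (v \<eta>' j)" for x
      using nth_cylinder[OF that, of "length (s i)"] by (simp add: t)
    ultimately show ?thesis
      using ef(3) by blast
  qed
  then have "cylinder (v \<eta> i) \<inter> cylinder (v \<eta>' j) = {}" if "i \<noteq> j" for \<eta> \<eta>' i j
    using that by (metis inf_commute nat_neq_iff)
  ultimately show ?thesis
    by (intro that[of v]) blast+
qed

section \<open>Minimality and pure infiniteness of the reduction\<close>

lemma openin_unit_embedding_vimage:
  assumes "openin (unit_space (sft_groupoid D)) T"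
  shows "openin (sft_space D) {x \<in> sft D. unit_embedding x \<in> T}"
  using openin_continuous_map_preimage[OF
      homeomorphic_imp_continuous_map[OF homeomorphic_map_unit_embedding] assms]
  by (simp add: topspace_sft_space)

lemma minimal_reduction:
  assumes irred: "irreducible_matrix (verts D) (adj_matrix D)"
    and Y: "openin (sft_space D) Y"
  shows "minimal (reduction (sft_groupoid D) (unit_embedding ` Y))"
    (is "minimal ?R")
proof -
  have Y_sub: "Y \<subseteq> sft D"
    using openin_subset[OF Y] by (simp add: topspace_sft_space)
  then have YU: "unit_embedding ` Y \<subseteq> units (sft_groupoid D)"
    by (simp add: units_sft_groupoid image_mono)
  note units = groupoid.units_reduction[OF groupoid_sft_groupoid YU]
  note space = groupoid.unit_space_reduction[OF groupoid_sft_groupoid YU]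
  have opY: "openin (unit_space (sft_groupoid D)) (unit_embedding ` Y)"
    by (simp add: openin_unit_embedding_image_iff Y_sub Y)
  have top: "topspace (unit_space ?R) = units ?R"
    using openin_subset[OF opY] by (simp add: space units inf.absorb2)
  show ?thesis
    unfolding minimal_def top[symmetric] dense_intersects_open
  proof (intro ballI allI impI)
    fix u T
    assume u: "u \<in> topspace (unit_space ?R)" and T: "openin (unit_space ?R) T \<and> T \<noteq> {}"
    obtain x where x: "x \<in> Y" "u = unit_embedding x"
      using u unfolding top units by blast
    have T_sub: "T \<subseteq> unit_embedding ` Y"
      using T openin_subset[of "unit_space ?R" T] unfolding top units by blast
    then obtain y where y: "y \<in> Y" "unit_embedding y \<in> T"
      using T by blast
    have "openin (unit_space (sft_groupoid D)) T"
      using T openin_open_subtopology[OF opY] unfolding space by blast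
    then have "openin (sft_space D) {x \<in> sft D. unit_embedding x \<in> T}"
      by (rule openin_unit_embedding_vimage)
    then have "\<forall>\<^sub>F n in sequentially. cylinder (prefix n y) \<subseteq> {x \<in> sft D. unit_embedding x \<in> T}"
      using y Y_sub by (intro eventually_cylinder_subset) auto
    \<comment> \<open>With \<open>n \<ge> 1\<close> the word built from \<open>prefix n y\<close> is
      nonempty, whatever the connecting walk, so its end vertex decides that \<open>x\<close> may
      follow.\<close>
    then obtain n where n: "cylinder (prefix n y) \<subseteq> {x \<in> sft D. unit_embedding x \<in> T}" "n \<ge> 1"
      using eventually_happens'[OF sequentially_bot eventually_conj[OF _ eventually_ge_at_top[of 1]]]
      by blast
    have xy: "x \<in> sft D" "y \<in> sft D"
      using x y Y_sub by auto
    have "tail D (z k) \<in> verts D" if "z \<in> sft D" for z k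
      using that by (auto simp: sft_def)
    then obtain p where "awalk (tail D (y n)) p (tail D (x 0))"
      using irreducible_imp_awalk[OF irred] xy by meson
    then have w: "awalk (tail D (y 0)) (prefix n y @ p) (tail D (x 0))"
      using awalk_prefix[OF xy(2)] by (rule awalk_appendI[rotated])
    define z where "z = (prefix n y @ p) \<frown> x"
    have z: "z \<in> sft D"
      unfolding z_def using w n(2) xy(1) by (subst conc_walk_in_sft_iff) auto
    have "z \<in> cylinder (prefix n y @ p)"
      using z by (simp add: cylinder_def z_def)
    then have zT: "unit_embedding z \<in> T"
      using cylinder_append_subset n(1) by blast
    \<comment> \<open>The arrow from \<open>x\<close> to \<open>z\<close> has to stay in the
      reduction; its range lies in \<open>T\<close>, which consists of units from
      \<open>Y\<close>.\<close>
    then have "z \<in> Y"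
      using T_sub by (auto simp: image_iff)
    have "(z, int (length (prefix n y @ p)) - int 0, x) \<in> arrows (sft_groupoid D)"
      by (rule arrow_sft_groupoidI[OF z xy(1) _ refl]) (simp only: z_def suffix_conc_length suffix_0)
    then have "(z, int (length (prefix n y @ p)) - int 0, x) \<in> arrows ?R"
      using x(1) \<open>z \<in> Y\<close> by (simp add: arrows_reduction)
    then have "unit_embedding z \<in> orbit ?R u"
      unfolding orbit_def x(2)
      by (intro CollectI exI[of _ "(z, int (length (prefix n y @ p)) - int 0, x)"]) simp
    then show "orbit ?R u \<inter> T \<noteq> {}"
      using zT by blast
  qed
qed

text \<open>
  Cut \<open>A\<close> into the cylinder sets of finitely many words \<open>w\<close> of a common length. The map exchanging each
  \<open>w\<close> for one of infinitely many incomparable words inside \<open>A\<close> is defined on all of \<open>A\<close>; even and odd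
  indices give two such maps with disjoint ranges.
\<close>

lemma clopenin_paradoxical:
  assumes irred: "irreducible_matrix (verts D) (adj_matrix D)"
    and not_perm: "\<not> permutation_matrix (verts D) (adj_matrix D)"
    and A: "clopenin (sft_space D) A"
  obtains U V where "compact_open_G_set (sft_groupoid D) U" "compact_open_G_set (sft_groupoid D) V"
    "gsrc (sft_groupoid D) ` U = unit_embedding ` A" "gsrc (sft_groupoid D) ` V = unit_embedding ` A"
    "grng (sft_groupoid D) ` U \<union> grng (sft_groupoid D) ` V \<subseteq> unit_embedding ` A"
    "grng (sft_groupoid D) ` U \<inter> grng (sft_groupoid D) ` V = {}"
proof (cases "A = {}")
  \<comment> \<open>The construction below starts from a point of \<open>A\<close>; for the empty
    set the empty \<open>G\<close>-sets serve.\<close>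
  case True
  then show ?thesis
    by (intro that[of "{}" "{}"]) (simp_all add: compact_open_G_set_def is_G_set_def)
next
  case False
  then obtain x0 where x0: "x0 \<in> A"
    by blast
  have A_sub: "A \<subseteq> sft D"
    using A openin_subset[of "sft_space D" A] by (simp add: clopenin_def topspace_sft_space)
  obtain N where N: "N \<ge> 1" "\<And>x. x \<in> A \<Longrightarrow> cylinder (prefix N x) \<subseteq> A"
    using clopenin_union_of_cylinders[OF A] by blast
  define W where "W = prefix N ` A"
  have len: "length w = N" if "w \<in> W" for w
    using that by (auto simp: W_def)
  have "x k \<in> arcs D" if "x \<in> A" for x k
    using that A_sub by (auto simp: sft_def)
  then have "W \<subseteq> {w. set w \<subseteq> arcs D \<and> length w = N}"
    by (auto simp: W_def)
  then have "finite W"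
    by (rule finite_subset) (simp add: finite_lists_length_eq)
  then obtain g :: "'e list \<Rightarrow> nat" where g: "inj_on g W"
    using finite_imp_inj_to_nat_seg by metis
  have "\<exists>\<eta> \<xi>. \<eta> \<in> verts D \<and> awalk \<xi> w \<eta>" if w: "w \<in> W" for w
  proof -
    obtain x where "x \<in> A" "w = prefix N x"
      using w by (auto simp: W_def)
    then have "awalk (tail D (x 0)) w (tail D (x N))"
      using awalk_prefix A_sub by blast
    then show ?thesis
      using awalk_last_in_verts by blast
  qed
  then obtain \<eta> where \<eta>: "\<And>w. w \<in> W \<Longrightarrow> \<eta> w \<in> verts D" "\<And>w. w \<in> W \<Longrightarrow> \<exists>\<xi>. awalk \<xi> w (\<eta> w)"
    by metis
  have u: "awalk (tail D (x0 0)) (prefix N x0) (tail D (x0 N))"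
    using awalk_prefix A_sub x0 by blast
  \<comment> \<open>All replacements are taken inside the single cylinder set of
    \<open>prefix N x0\<close>, which lies in \<open>A\<close>.\<close>
  obtain v :: "'v \<Rightarrow> nat \<Rightarrow> 'e list"
    where v: "\<And>\<eta> j. \<eta> \<in> verts D \<Longrightarrow> awalk (tail D (x0 0)) (v \<eta> j) \<eta>"
      "\<And>\<eta> j. v \<eta> j \<noteq> []" "\<And>\<eta> j. cylinder (v \<eta> j) \<subseteq> cylinder (prefix N x0)"
      "\<And>\<eta> \<eta>' i j. i \<noteq> j \<Longrightarrow> cylinder (v \<eta> i) \<inter> cylinder (v \<eta>' j) = {}"
    using disjoint_extensions[OF irred not_perm u] by blast
  \<comment> \<open>The injective numbering \<open>g\<close> separates the words for fixed
    \<open>i\<close>; the parity of the index separates \<open>i = 0\<close> from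
    \<open>i = 1\<close>, even for the same word.\<close>
  define m where "m i w = v (\<eta> w) (2 * g w + i)" for i w
  have inter: "interchangeable (m i w) w" if w: "w \<in> W" for i w
  proof -
    obtain \<xi> where "awalk \<xi> w (\<eta> w)"
      using \<eta>(2)[OF w] by blast
    moreover have "w \<noteq> []"
      using len[OF w] N(1) by auto
    ultimately show ?thesis
      unfolding m_def by (rule walks_interchangeable[OF v(1)[OF \<eta>(1)[OF w]] _ v(2)])
  qed
  have src: "cylinder w \<inter> cylinder w' = {}" if "w \<in> W" "w' \<in> W" "w \<noteq> w'" for w w'
    using that len by (intro disjoint_cylinders_eq_length) auto
  have rng: "cylinder (m i w) \<inter> cylinder (m i w') = {}" if "w \<in> W" "w' \<in> W" "w \<noteq> w'" for i w w'
    unfolding m_def using that g by (intro v(4)) (auto simp: inj_on_def)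
  have rng': "cylinder (m 0 w) \<inter> cylinder (m 1 w') = {}" for w w'
    unfolding m_def by (intro v(4)) presburger
  have cover: "(\<Union>w\<in>W. cylinder w) = A"
    using N(2) A_sub by (auto simp: W_def cylinder_def)
  have m_sub: "(\<Union>w\<in>W. cylinder (m i w)) \<subseteq> A" for i
    using v(3) N(2)[OF x0] unfolding m_def by blast
  note U = compact_open_G_set_Union_bisection[of W, OF \<open>finite W\<close> inter src rng]
  let ?U = "\<lambda>i. \<Union>w\<in>W. bisection (m i w) w"
  show ?thesis
  proof (rule that[of "?U 0" "?U 1"])
    show "compact_open_G_set (sft_groupoid D) (?U 0)" "compact_open_G_set (sft_groupoid D) (?U 1)"
      by (rule U(1); assumption)+
    have s: "gsrc (sft_groupoid D) ` ?U i = unit_embedding ` A" for i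
      unfolding cover[symmetric] by (rule U(3); assumption)
    show "gsrc (sft_groupoid D) ` ?U 0 = unit_embedding ` A"
      "gsrc (sft_groupoid D) ` ?U 1 = unit_embedding ` A"
      by (rule s)+
    have r: "grng (sft_groupoid D) ` ?U i = unit_embedding ` (\<Union>w\<in>W. cylinder (m i w))" for i
      by (rule U(2); assumption)
    show "grng (sft_groupoid D) ` ?U 0 \<union> grng (sft_groupoid D) ` ?U 1 \<subseteq> unit_embedding ` A"
      unfolding r using m_sub[of 0] m_sub[of 1] by (intro Un_least image_mono)
    have "(\<Union>w\<in>W. cylinder (m 0 w)) \<inter> (\<Union>w\<in>W. cylinder (m 1 w)) = {}"
      using rng' by blast
    then show "grng (sft_groupoid D) ` ?U 0 \<inter> grng (sft_groupoid D) ` ?U 1 = {}"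
      unfolding r image_Int[OF inj_unit_embedding, symmetric] by simp
  qed
qed

text \<open>As \<open>Y\<close> is clopen, a clopen subset of the smaller unit space is clopen in
  the whole one. The \<open>G\<close>-sets found in the full groupoid have both ends in
  \<open>B\<close>, hence they already lie in the reduction.\<close>

lemma purely_infinite_reduction:
  assumes irred: "irreducible_matrix (verts D) (adj_matrix D)"
    and not_perm: "\<not> permutation_matrix (verts D) (adj_matrix D)"
    and Y: "clopenin (sft_space D) Y"
  shows "purely_infinite (reduction (sft_groupoid D) (unit_embedding ` Y))"
    (is "purely_infinite ?R")
  unfolding purely_infinite_def
proof (intro allI impI)
  fix B
  assume B: "clopenin (unit_space ?R) B"
  have Y_sub: "Y \<subseteq> sft D"
    using Y openin_subset[of "sft_space D" Y] by (simp add: clopenin_def topspace_sft_space)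
  then have YU: "unit_embedding ` Y \<subseteq> units (sft_groupoid D)"
    by (simp add: units_sft_groupoid image_mono)
  note space = groupoid.unit_space_reduction[OF groupoid_sft_groupoid YU]
  have YG: "openin (unit_space (sft_groupoid D)) (unit_embedding ` Y)"
      "closedin (unit_space (sft_groupoid D)) (unit_embedding ` Y)"
    using Y by (simp_all add: clopenin_def openin_unit_embedding_image_iff
        closedin_unit_embedding_image_iff Y_sub)
  have B': "openin (unit_space (sft_groupoid D)) B" "closedin (unit_space (sft_groupoid D)) B"
      "B \<subseteq> unit_embedding ` Y"
    using B openin_open_subtopology[OF YG(1)] closedin_closed_subtopology[OF YG(2)]
    unfolding clopenin_def space by blast+
  obtain A where A: "A \<subseteq> Y" "B = unit_embedding ` A"
    using B'(3) subset_image_iff by metis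
  then have "clopenin (sft_space D) A"
    using B'(1,2) Y_sub
    by (simp add: clopenin_def openin_unit_embedding_image_iff closedin_unit_embedding_image_iff)
  then obtain U V where UV: "compact_open_G_set (sft_groupoid D) U" "compact_open_G_set (sft_groupoid D) V"
      "gsrc (sft_groupoid D) ` U = B" "gsrc (sft_groupoid D) ` V = B"
      "grng (sft_groupoid D) ` U \<union> grng (sft_groupoid D) ` V \<subseteq> B"
      "grng (sft_groupoid D) ` U \<inter> grng (sft_groupoid D) ` V = {}"
    using clopenin_paradoxical[OF irred not_perm] unfolding A(2) by metis
  have "compact_open_G_set ?R U" "compact_open_G_set ?R V"
    using UV B'(3) by (intro compact_open_G_set_reduction; blast)+
  then show "properly_infinite ?R B"
    unfolding properly_infinite_def reduction_simps using UV(3-6) by blast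
qed

end

theorem lemma6p1:
  fixes D :: "('v, 'e) pre_digraph" and Y :: "(nat \<Rightarrow> 'e) set"
  assumes "fin_digraph D"
    and "irreducible_matrix (verts D) (adj_matrix D)"
    and "\<not> permutation_matrix (verts D) (adj_matrix D)"
    and "clopenin (sft_space D) Y" and "Y \<noteq> {}"
  shows "etale_groupoid (reduction (sft_groupoid D) (unit_embedding ` Y)) \<and>
         purely_infinite (reduction (sft_groupoid D) (unit_embedding ` Y)) \<and>
         minimal (reduction (sft_groupoid D) (unit_embedding ` Y))"
proof -
  interpret fin_digraph D
    by (rule assms(1))
  interpret finite_graph_shift D
    by unfold_locales
  have Y: "openin (sft_space D) Y"
    using assms(4) by (simp add: clopenin_def)
  then have "Y \<subseteq> sft D"
    using openin_subset by (metis topspace_sft_space)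
  then have "openin (unit_space (sft_groupoid D)) (unit_embedding ` Y)"
    by (simp add: openin_unit_embedding_image_iff Y)
  then have "etale_groupoid (reduction (sft_groupoid D) (unit_embedding ` Y))"
    by (rule etale_groupoid.etale_groupoid_reduction[OF etale_groupoid_sft_groupoid])
  then show ?thesis
    using purely_infinite_reduction[OF assms(2-4)] minimal_reduction[OF assms(2) Y] by blast
qed

end
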